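(* Let $T_1,T_2,T_3$ be contractions on complex Hilbert spaces $\mathbb{H}_1,\mathbb{H}_2,\mathbb{H}_3$ respectively, with $\mathbb{T}\subseteq\sigma(T_i)$ for $i=1,2,3$. Then the operator space structure on $\ell^1(3)$ induced by the isometry $f:\ell^1(3)\to\mathcal{B}(\mathbb{H}_1\otimes\mathbb{H}_2\otimes\mathbb{H}_3)$, $f(a_1,a_2,a_3)=a_1T_1\otimes I\otimes I+a_2I\otimes T_2\otimes I+a_3I\otimes I\otimes T_3$, is completely isometric to the MIN structure: $f$ is a complete isometry from $\mathrm{MIN}(\ell^1(3))$ onto its image.
   Context: $\ell^1(3)$ is $\mathbb{C}^3$ with the norm $|a_1|+|a_2|+|a_3|$; $\mathbb{T}$ is the unit circle and $\sigma$ denotes spectrum. The MIN operator space structure on a normed space $W$ is given, for $(v_{ij})\in M_k(W)$, by $\|(v_{ij})\|_{MIN}=\sup\{\|(g(v_{ij}))\|_{M_k}: g\in W^*,\ \|g\|\le 1\}$. The operator space structure induced by an isometry $f:W\to\mathcal{B}(\mathbb{K})$ has matrix norms $\|(v_{ij})\|_k=\|(f(v_{ij}))\|_{\mathcal{B}(\mathbb{K}^k)}$. A linear map is a complete isometry if all its amplifications $f\otimes I_k$, $k\in\mathbb{N}$, are isometries. *)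

theory Defs
  imports "HOL-Analysis.Analysis"
begin

section \<open>Complex normed spaces and complex Hilbert spaces\<close>

class complex_vector = real_vector +
  fixes scaleC :: "complex \<Rightarrow> 'a \<Rightarrow> 'a"  (infixr "*\<^sub>C" 75)
  assumes scaleC_add_right: "c *\<^sub>C (x + y) = c *\<^sub>C x + c *\<^sub>C y"
    and scaleC_add_left: "(c + d) *\<^sub>C x = c *\<^sub>C x + d *\<^sub>C x"
    and scaleC_scaleC: "c *\<^sub>C (d *\<^sub>C x) = (c * d) *\<^sub>C x"
    and scaleR_scaleC: "r *\<^sub>R x = complex_of_real r *\<^sub>C x"

lemma scaleC_one: "1 *\<^sub>C (x :: 'a::complex_vector) = x"
  using scaleR_scaleC[of 1 x] by simp

global_interpretation complex_vector: vector_space "scaleC :: complex \<Rightarrow> 'a \<Rightarrow> 'a::complex_vector"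
  by standard (simp_all add: scaleC_add_right scaleC_add_left scaleC_scaleC scaleC_one)

class complex_normed_vector = complex_vector + real_normed_vector +
  assumes norm_scaleC: "norm (c *\<^sub>C x) = cmod c * norm x"

text \<open>The inner product is linear in the first argument. Positive definiteness and the relation
  between norm and inner product are inherited from \<^class>\<open>real_inner\<close>, whose (unique) real
  inner product is the real part of the complex one.\<close>

class complex_inner = complex_vector + real_inner +
  fixes cinner :: "'a \<Rightarrow> 'a \<Rightarrow> complex"
  assumes cinner_add_left: "cinner (x + y) z = cinner x z + cinner y z"
    and cinner_scaleC_left: "cinner (c *\<^sub>C x) y = c * cinner x y"
    and cinner_commute: "cinner x y = cnj (cinner y x)"
    and inner_eq_Re_cinner: "inner x y = Re (cinner x y)"
begin

lemma cinner_scaleC_right: "cinner x (c *\<^sub>C y) = cnj c * cinner x y"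
  by (metis cinner_commute cinner_scaleC_left complex_cnj_mult)

subclass complex_normed_vector
proof
  fix c :: complex and x :: 'a
  have im: "Im (cinner x x) = 0"
    using arg_cong[OF cinner_commute[of x x], of Im] by simp
  have "inner (c *\<^sub>C x) (c *\<^sub>C x) = (cmod c)\<^sup>2 * inner x x"
    unfolding inner_eq_Re_cinner cinner_scaleC_left cinner_scaleC_right cmod_power2
    by (simp add: im power2_eq_square distrib_right)
  then show "norm (c *\<^sub>C x) = cmod c * norm x"
    by (simp add: norm_eq_sqrt_inner[of x] norm_eq_sqrt_inner[of "c *\<^sub>C x"] real_sqrt_mult)
qed

lemma cinner_self: "cinner x x = complex_of_real ((norm x)\<^sup>2)"
proof -
  have "Im (cinner x x) = 0"
    using arg_cong[OF cinner_commute[of x x], of Im] by simp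
  then show ?thesis
    by (simp add: complex_eq_iff power2_norm_eq_inner inner_eq_Re_cinner)
qed

end

class complex_hilbert_space = complex_inner + complete_space

instantiation complex :: complex_hilbert_space
begin
definition "scaleC (c :: complex) (z :: complex) = c * z"
definition "cinner (z :: complex) (w :: complex) = z * cnj w"
instance
  by standard
    (simp_all add: scaleC_complex_def cinner_complex_def algebra_simps inner_complex_def
      scaleR_conv_of_real)
end

section \<open>Bounded operators and spectrum\<close>

definition bounded_clinear ::
    "('a::complex_normed_vector \<Rightarrow> 'b::complex_normed_vector) \<Rightarrow> bool" where
  "bounded_clinear f \<longleftrightarrow> bounded_linear f \<and> (\<forall>c x. f (c *\<^sub>C x) = c *\<^sub>C f x)"

definition contraction :: "('a::complex_normed_vector \<Rightarrow> 'a) \<Rightarrow> bool" where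
  "contraction T \<longleftrightarrow> bounded_clinear T \<and> onorm T \<le> 1"

definition spectrum :: "('a::complex_normed_vector \<Rightarrow> 'a) \<Rightarrow> complex set" where
  "spectrum T = {\<mu>. \<not> (\<exists>S. bounded_clinear S \<and>
     (\<forall>x. S (T x - \<mu> *\<^sub>C x) = x) \<and> (\<forall>x. T (S x) - \<mu> *\<^sub>C S x = x))}"

section \<open>Hilbert space tensor products\<close>

text \<open>A Hilbert space \<open>'k\<close> together with a map \<open>t x y z = x \<otimes> y \<otimes> z\<close> is (a model of) the completed
  tensor product of three Hilbert spaces; this determines it up to a unique unitary compatible
  with the elementary tensors.\<close>

definition hilbert_tensor3 ::
    "('a::complex_hilbert_space \<Rightarrow> 'b::complex_hilbert_space \<Rightarrow> 'c::complex_hilbert_space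
      \<Rightarrow> 'k::complex_hilbert_space) \<Rightarrow> bool" where
  "hilbert_tensor3 t \<longleftrightarrow>
     (\<forall>y z. Vector_Spaces.linear scaleC scaleC (\<lambda>x. t x y z)) \<and>
     (\<forall>x z. Vector_Spaces.linear scaleC scaleC (\<lambda>y. t x y z)) \<and>
     (\<forall>x y. Vector_Spaces.linear scaleC scaleC (\<lambda>z. t x y z)) \<and>
     (\<forall>x y z x' y' z'. cinner (t x y z) (t x' y' z') = cinner x x' * cinner y y' * cinner z z') \<and>
     closure (complex_vector.span {t x y z | x y z. True}) = UNIV"

text \<open>The operator \<open>A \<otimes> B \<otimes> C\<close>; for bounded \<open>A\<close>, \<open>B\<close>, \<open>C\<close> it exists, and it is unique by density
  of the span of the elementary tensors.\<close>

definition tensor_op3 ::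
    "('a::complex_hilbert_space \<Rightarrow> 'b::complex_hilbert_space \<Rightarrow> 'c::complex_hilbert_space
      \<Rightarrow> 'k::complex_hilbert_space) \<Rightarrow> ('a \<Rightarrow> 'a) \<Rightarrow> ('b \<Rightarrow> 'b) \<Rightarrow> ('c \<Rightarrow> 'c) \<Rightarrow> 'k \<Rightarrow> 'k" where
  "tensor_op3 t A B C =
     (THE F. bounded_clinear F \<and> (\<forall>x y z. F (t x y z) = t (A x) (B y) (C z)))"

section \<open>Matrix norms\<close>

text \<open>A \<open>k \<times> k\<close> matrix is a function of two indices of which only the values at indices below \<open>k\<close>
  matter. The next definition is the norm of an operator matrix acting on the Hilbert space
  direct sum of \<open>k\<close> copies of \<open>'h\<close>.\<close>

definition op_matrix_norm :: "nat \<Rightarrow> (nat \<Rightarrow> nat \<Rightarrow> 'h \<Rightarrow> 'h::complex_hilbert_space) \<Rightarrow> real" where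
  "op_matrix_norm k A =
     Sup {sqrt (\<Sum>i<k. (norm (\<Sum>j<k. A i j (x j)))\<^sup>2) | x. (\<Sum>j<k. (norm (x j))\<^sup>2) \<le> 1}"

definition scalar_matrix_norm :: "nat \<Rightarrow> (nat \<Rightarrow> nat \<Rightarrow> complex) \<Rightarrow> real" where
  "scalar_matrix_norm k M = op_matrix_norm k (\<lambda>i j z. M i j * z)"

definition min_matrix_norm :: "nat \<Rightarrow> (nat \<Rightarrow> nat \<Rightarrow> 'w::complex_normed_vector) \<Rightarrow> real" where
  "min_matrix_norm k v =
     Sup {scalar_matrix_norm k (\<lambda>i j. g (v i j)) | g :: 'w \<Rightarrow> complex.
            bounded_clinear g \<and> onorm g \<le> 1}"

text \<open>Maps into the bounded operators on a Hilbert space \<open>'h\<close>. For \<open>complete_isometry\<close> the domain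
  carries the matrix norms \<open>N k\<close>.\<close>

definition linear_into_operators ::
    "('w::complex_vector \<Rightarrow> 'h \<Rightarrow> 'h::complex_hilbert_space) \<Rightarrow> bool" where
  "linear_into_operators f \<longleftrightarrow>
     (\<forall>w. bounded_clinear (f w)) \<and> (\<forall>x. Vector_Spaces.linear scaleC scaleC (\<lambda>w. f w x))"

definition isometry_into_operators ::
    "('w::complex_normed_vector \<Rightarrow> 'h \<Rightarrow> 'h::complex_hilbert_space) \<Rightarrow> bool" where
  "isometry_into_operators f \<longleftrightarrow> linear_into_operators f \<and> (\<forall>w. onorm (f w) = norm w)"

definition complete_isometry ::
    "(nat \<Rightarrow> (nat \<Rightarrow> nat \<Rightarrow> 'w) \<Rightarrow> real)
      \<Rightarrow> ('w::complex_normed_vector \<Rightarrow> 'h \<Rightarrow> 'h::complex_hilbert_space) \<Rightarrow> bool" where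
  "complete_isometry N f \<longleftrightarrow> linear_into_operators f \<and>
     (\<forall>k v. op_matrix_norm k (\<lambda>i j. f (v i j)) = N k v)"

section \<open>Finite-dimensional complex \<open>\<ell>\<^sup>1\<close>\<close>

typedef 'n l1 = "UNIV :: ('n \<Rightarrow> complex) set"
  morphisms l1_nth l1_of ..

setup_lifting type_definition_l1

lemma l1_eqI: "(\<And>i. l1_nth a i = l1_nth b i) \<Longrightarrow> a = b"
  by (simp add: l1_nth_inject[symmetric] fun_eq_iff)

instantiation l1 :: (finite) complex_normed_vector
begin

lift_definition zero_l1 :: "'a l1" is "\<lambda>_. 0" .
lift_definition plus_l1 :: "'a l1 \<Rightarrow> 'a l1 \<Rightarrow> 'a l1" is "\<lambda>a b i. a i + b i" .
lift_definition minus_l1 :: "'a l1 \<Rightarrow> 'a l1 \<Rightarrow> 'a l1" is "\<lambda>a b i. a i - b i" .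
lift_definition uminus_l1 :: "'a l1 \<Rightarrow> 'a l1" is "\<lambda>a i. - a i" .
lift_definition scaleR_l1 :: "real \<Rightarrow> 'a l1 \<Rightarrow> 'a l1" is "\<lambda>r a i. r *\<^sub>R a i" .
lift_definition scaleC_l1 :: "complex \<Rightarrow> 'a l1 \<Rightarrow> 'a l1" is "\<lambda>c a i. c * a i" .
lift_definition norm_l1 :: "'a l1 \<Rightarrow> real" is "\<lambda>a. \<Sum>i\<in>UNIV. cmod (a i)" .

definition "sgn_l1 (a :: 'a l1) = scaleR (inverse (norm a)) a"
definition "dist_l1 (a :: 'a l1) b = norm (a - b)"
definition "uniformity_l1 = (INF e\<in>{0<..}. principal {(x :: 'a l1, y). dist x y < e})"
definition "open_l1 (U :: 'a l1 set) \<longleftrightarrow>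
  (\<forall>x\<in>U. eventually (\<lambda>(x', y). x' = x \<longrightarrow> y \<in> U) uniformity)"

instance
proof
  fix a b :: "'a l1" and c d :: complex and r s :: real
  show "c *\<^sub>C (a + b) = c *\<^sub>C a + c *\<^sub>C b" by transfer (simp add: algebra_simps)
  show "(c + d) *\<^sub>C a = c *\<^sub>C a + d *\<^sub>C a" by transfer (simp add: algebra_simps)
  show "c *\<^sub>C (d *\<^sub>C a) = (c * d) *\<^sub>C a" by transfer (simp add: algebra_simps)
  show "r *\<^sub>R a = complex_of_real r *\<^sub>C a" by transfer (simp add: scaleR_conv_of_real)
  show "norm (c *\<^sub>C a) = cmod c * norm a" by transfer (simp only: norm_mult sum_distrib_left)
  show "norm (r *\<^sub>R a) = \<bar>r\<bar> * norm a" by transfer (simp only: norm_scaleR sum_distrib_left)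
  show "norm a = 0 \<longleftrightarrow> a = 0" by transfer (simp add: sum_nonneg_eq_0_iff fun_eq_iff)
  show "norm (a + b) \<le> norm a + norm b"
    by transfer (subst sum.distrib[symmetric], intro sum_mono norm_triangle_ineq)
  fix e :: "'a l1"
  show "a + b + e = a + (b + e)" by transfer (simp add: algebra_simps)
  show "a + b = b + a" by transfer (simp add: algebra_simps)
  show "0 + a = a" by transfer simp
  show "- a + a = 0" by transfer simp
  show "a - b = a + - b" by transfer simp
  show "r *\<^sub>R (a + b) = r *\<^sub>R a + r *\<^sub>R b" by transfer (simp add: algebra_simps)
  show "(r + s) *\<^sub>R a = r *\<^sub>R a + s *\<^sub>R a" by transfer (simp add: algebra_simps)
  show "r *\<^sub>R s *\<^sub>R a = (r * s) *\<^sub>R a" by transfer simp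
  show "1 *\<^sub>R a = a" by transfer simp
  show "sgn a = scaleR (inverse (norm a)) a" by (rule sgn_l1_def)
  show "dist a b = norm (a - b)" by (rule dist_l1_def)
  show "(uniformity :: ('a l1 \<times> 'a l1) filter) = (INF e\<in>{0<..}. principal {(x, y). dist x y < e})"
    by (rule uniformity_l1_def)
  show "open U \<longleftrightarrow> (\<forall>x\<in>U. \<forall>\<^sub>F (x', y) in uniformity. x' = x \<longrightarrow> y \<in> U)" for U :: "'a l1 set"
    by (rule open_l1_def)
qed

end

text \<open>\<open>\<ell>\<^sup>1(3)\<close> is the type \<open>3 l1\<close>. Its coordinates are indexed by the three distinct elements
  \<open>1\<close>, \<open>2\<close>, \<open>3\<close> (with \<open>3 = 0\<close>) of the numeral type \<open>3\<close>.\<close>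

lemma norm_l1_3: "norm (a :: 3 l1) = cmod (l1_nth a 1) + cmod (l1_nth a 2) + cmod (l1_nth a 3)"
  unfolding norm_l1.rep_eq sum_3 ..

end

theory Submission
  imports Defs
begin

text \<open>
  Write \<open>F\<^sub>1\<close>, \<open>F\<^sub>2\<close>, \<open>F\<^sub>3\<close> for the operators \<open>T\<^sub>1 \<otimes> I \<otimes> I\<close>, \<open>I \<otimes> T\<^sub>2 \<otimes> I\<close>, \<open>I \<otimes> I \<otimes> T\<^sub>3\<close> on the
  tensor product \<open>K\<close>. A matrix over \<open>\<ell>\<^sup>1(3)\<close> is a triple of scalar matrices \<open>V\<^sub>1\<close>, \<open>V\<^sub>2\<close>, \<open>V\<^sub>3\<close>, and its
  image is the pencil \<open>\<Sum>\<^sub>m V\<^sub>m F\<^sub>m\<close> acting on \<open>K\<^sup>k\<close>. Functionals of norm at most one on \<open>\<ell>\<^sup>1(3)\<close> are the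
  points \<open>z\<close> of the closed tridisc, so the MIN norm is the supremum of the norms of the scalar matrices
  \<open>\<Sum>\<^sub>m z\<^sub>m V\<^sub>m\<close>; by convexity points of the torus suffice. The theorem says that the two norms agree.

  The pencil dominates the scalar matrices because a point of the unit circle in the spectrum of
  a contraction is an approximate eigenvalue: otherwise \<open>T - z\<close> is bounded below, and its range is dense since
  \<open>T - \<mu>\<close> is onto for the points \<open>\<mu>\<close> outside the disc near \<open>z\<close>, so \<open>T - z\<close> is invertible. Tensors of approximate
  eigenvectors are joint approximate eigenvectors of \<open>F\<^sub>1\<close>, \<open>F\<^sub>2\<close>, \<open>F\<^sub>3\<close>
  (\<open>approximate_eigenvector\<close>, \<open>tensor_pencil_lower_bound\<close>).

  Conversely, the scalars \<open>z\<^sub>m\<close> are replaced by the operators \<open>F\<^sub>m\<close> one at a time (\<open>pencil_upper_bound\<close>). The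
  classical reason why this does not increase the norm is that \<open>T\<^sub>m\<close> dilates to a unitary acting on its own
  tensor factor. Here the dilation is replaced by inequalities between quadratic forms. If \<open>A\<close> and \<open>B\<close> commute with a
  contraction \<open>F\<close>, the sequence space in which \<open>F\<close> has an isometric dilation carries the quadratic form
  \<open>\<parallel>x\<^sub>0\<parallel>\<^sup>2 + \<Sum>\<^bsub>i\<ge>1\<^esub> (\<parallel>x\<^sub>i\<parallel>\<^sup>2 - \<parallel>F x\<^sub>i\<parallel>\<^sup>2)\<close>, and testing \<open>z A + B\<close> on the vectors \<open>\<Sum>\<^bsub>n<N\<^esub> z\<^sup>n F\<^sup>n x\<close>, averaged over
  roots of unity \<open>z\<close>, bounds \<open>A + B F\<close> by the supremum of the norms of \<open>z A + B\<close> (\<open>dilation_inequality\<close>). This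
  needs \<open>z A + B\<close> to be bounded for the defect form \<open>\<parallel>x\<parallel>\<^sup>2 - \<parallel>F x\<parallel>\<^sup>2\<close> as well as for the norm. It is, when \<open>A\<close> and
  \<open>B\<close> act on the other two factors: the required inequality says that a tensor product of positive forms is
  positive, which on finite sums of elementary tensors is the Schur product theorem
  (\<open>schur_product_nonneg\<close>, \<open>slot3_defect\<close>). The Schur product theorem also gives the existence of the operators
  \<open>F\<^sub>m\<close> and the case in which all three of them are scalars.
\<close>

section \<open>Positive semidefinite matrices and the Schur product\<close>

text \<open>The weights are applied to the indices as \<open>\<xi> i * cnj (\<xi> j)\<close>, matching an inner product that is linear in
  its first argument.\<close>

definition psd :: "'i set \<Rightarrow> ('i \<Rightarrow> 'i \<Rightarrow> complex) \<Rightarrow> bool" where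
  "psd I P \<longleftrightarrow> (\<forall>i\<in>I. \<forall>j\<in>I. P j i = cnj (P i j)) \<and>
     (\<forall>\<xi>. 0 \<le> Re (\<Sum>i\<in>I. \<Sum>j\<in>I. \<xi> i * cnj (\<xi> j) * P i j))"

lemma psd_nonneg: "psd I P \<Longrightarrow> 0 \<le> Re (\<Sum>i\<in>I. \<Sum>j\<in>I. \<xi> i * cnj (\<xi> j) * P i j)"
  unfolding psd_def by blast

lemma psd_herm: "psd I P \<Longrightarrow> i \<in> I \<Longrightarrow> j \<in> I \<Longrightarrow> P j i = cnj (P i j)"
  unfolding psd_def by blast

lemma Re_of_real_mult: "Re (of_real a * z) = a * Re z"
  by simp

text \<open>Splitting off one index isolates the quadratic polynomial in \<open>\<xi> r\<close> that has to be completed to a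
  square in the Cholesky step.\<close>

lemma form_insert:
  assumes "finite I" "r \<notin> I" and herm: "\<And>i. i \<in> I \<Longrightarrow> P r i = cnj (P i r)"
  shows "Re (\<Sum>i\<in>insert r I. \<Sum>j\<in>insert r I. \<xi> i * cnj (\<xi> j) * P i j)
    = (cmod (\<xi> r))\<^sup>2 * Re (P r r) + 2 * Re (cnj (\<xi> r) * (\<Sum>i\<in>I. \<xi> i * P i r))
      + Re (\<Sum>i\<in>I. \<Sum>j\<in>I. \<xi> i * cnj (\<xi> j) * P i j)"
proof -
  have 1: "(\<Sum>j\<in>I. \<xi> r * cnj (\<xi> j) * P r j) = cnj (cnj (\<xi> r) * (\<Sum>i\<in>I. \<xi> i * P i r))"
    by (simp add: sum_distrib_left herm mult.assoc)
  have 2: "(\<Sum>i\<in>I. \<xi> i * cnj (\<xi> r) * P i r) = cnj (\<xi> r) * (\<Sum>i\<in>I. \<xi> i * P i r)"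
    by (simp add: sum_distrib_left mult_ac)
  have 3: "\<xi> r * cnj (\<xi> r) * P r r = of_real ((cmod (\<xi> r))\<^sup>2) * P r r"
    by (simp only: complex_norm_square)
  have "(\<Sum>i\<in>insert r I. \<Sum>j\<in>insert r I. \<xi> i * cnj (\<xi> j) * P i j) =
     \<xi> r * cnj (\<xi> r) * P r r + (\<Sum>j\<in>I. \<xi> r * cnj (\<xi> j) * P r j)
     + ((\<Sum>i\<in>I. \<xi> i * cnj (\<xi> r) * P i r) + (\<Sum>i\<in>I. \<Sum>j\<in>I. \<xi> i * cnj (\<xi> j) * P i j))"
    using assms(1,2) by (simp add: sum.distrib)
  then show ?thesis unfolding 1 2 3
    by (simp only: plus_complex.sel cnj.sel Re_of_real_mult)
qed

lemma psd_mono: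
  assumes "finite I" "psd I P" "J \<subseteq> I" shows "psd J P"
  unfolding psd_def
proof (intro conjI allI ballI)
  fix \<xi> :: "'a \<Rightarrow> complex"
  let ?e = "\<lambda>i. if i \<in> J then \<xi> i else 0"
  have "(\<Sum>i\<in>I. \<Sum>j\<in>I. ?e i * cnj (?e j) * P i j) = (\<Sum>i\<in>J. \<Sum>j\<in>I. ?e i * cnj (?e j) * P i j)"
    by (rule sum.mono_neutral_right) (use assms(1,3) in auto)
  also have "\<dots> = (\<Sum>i\<in>J. \<Sum>j\<in>J. \<xi> i * cnj (\<xi> j) * P i j)"
    by (rule sum.cong[OF refl], rule sum.mono_neutral_cong_right) (use assms(1,3) in auto)
  finally show "0 \<le> Re (\<Sum>i\<in>J. \<Sum>j\<in>J. \<xi> i * cnj (\<xi> j) * P i j)"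
    using psd_nonneg[OF assms(2), of ?e] by simp
next
  fix i j assume "i \<in> J" "j \<in> J"
  then show "P j i = cnj (P i j)"
    by (intro psd_herm[OF assms(2)]) (use assms(3) in auto)
qed

text \<open>Cholesky decomposition by induction on the index set. If the diagonal entry at the new index \<open>r\<close> is
  positive, its row contributes one factor, and the Schur complement of that entry is again positive
  semidefinite; if it vanishes, positivity forces the whole row to vanish.\<close>

lemma psd_factorization:
  assumes "finite I" "psd I P"
  shows "\<exists>p :: 'i \<Rightarrow> 'i \<Rightarrow> complex. \<forall>i\<in>I. \<forall>j\<in>I. P i j = (\<Sum>m\<in>I. p m i * cnj (p m j))"
  using assms
proof (induction I arbitrary: P rule: finite_induct)
  case empty then show ?case by simp
next
  case (insert r I)
  note fin = insert.hyps(1) and r = insert.hyps(2)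
  have psdI: "psd I P" by (rule psd_mono[OF _ insert.prems]) (use fin in auto)
  have herm: "P j i = cnj (P i j)" if "i \<in> insert r I" "j \<in> insert r I" for i j
    using psd_herm[OF insert.prems that] .
  define d where "d = Re (P r r)"
  have Prr: "P r r = of_real d"
    using herm[of r r] by (auto simp: d_def complex_eq_iff)
  have form: "0 \<le> (cmod (\<xi> r))\<^sup>2 * d + 2 * Re (cnj (\<xi> r) * (\<Sum>i\<in>I. \<xi> i * P i r))
      + Re (\<Sum>i\<in>I. \<Sum>j\<in>I. \<xi> i * cnj (\<xi> j) * P i j)" for \<xi>
  proof -
    have "P r i = cnj (P i r)" if "i \<in> I" for i by (rule herm) (use that in auto)
    from form_insert[of I r P \<xi>, OF fin r this] show ?thesis
      using psd_nonneg[OF insert.prems, of \<xi>] by (simp only: d_def)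
  qed
  have form': "0 \<le> (cmod s)\<^sup>2 * d + 2 * Re (cnj s * (\<Sum>i\<in>I. \<xi> i * P i r))
      + Re (\<Sum>i\<in>I. \<Sum>j\<in>I. \<xi> i * cnj (\<xi> j) * P i j)" for \<xi> s
  proof -
    have "(\<Sum>i\<in>I. (\<xi>(r := s)) i * P i r) = (\<Sum>i\<in>I. \<xi> i * P i r)"
      "(\<Sum>i\<in>I. \<Sum>j\<in>I. (\<xi>(r := s)) i * cnj ((\<xi>(r := s)) j) * P i j) = (\<Sum>i\<in>I. \<Sum>j\<in>I. \<xi> i * cnj (\<xi> j) * P i j)"
      by (intro sum.cong refl; use r in auto)+
    then show ?thesis using form[of "\<xi>(r := s)"] by simp
  qed
  have d0: "d \<ge> 0" using form'[of 1 "\<lambda>_. 0"] by simp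
  show ?case
  proof (cases "d = 0")
    case True
    have zero: "P i r = 0" if i: "i \<in> I" for i
    proof (rule ccontr)
      assume nz: "P i r \<noteq> 0"
      define q where "q = Re (P i i)"
      \<comment> \<open>With coordinate 1 at \<open>i\<close>, the form is affine in the coordinate at \<open>r\<close>, because \<open>P r r = 0\<close>; at \<open>s\<close> it is negative.\<close>
      define s where "s = - of_real ((\<bar>q\<bar> + 1) / (cmod (P i r))\<^sup>2) * P i r"
      let ?x = "\<lambda>j. if j = i then 1 else 0 :: complex"
      have delta: "(\<Sum>j\<in>I. ?x j * h j) = h i" for h :: "'i \<Rightarrow> complex"
      proof -
        have "(\<Sum>j\<in>I. ?x j * h j) = (\<Sum>j\<in>I. if j = i then h j else 0)"
          by (rule sum.cong[OF refl]) simp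
        then show ?thesis using i fin by (simp only: sum.delta if_True)
      qed
      have a: "(\<Sum>j\<in>I. ?x j * P j r) = P i r"
        by (rule delta)
      have cx: "cnj (?x l) = ?x l" for l by simp
      have "(\<Sum>j\<in>I. \<Sum>l\<in>I. ?x j * cnj (?x l) * P j l) = (\<Sum>j\<in>I. ?x j * (\<Sum>l\<in>I. ?x l * P j l))"
        by (simp only: sum_distrib_left mult.assoc cx)
      then have b: "(\<Sum>j\<in>I. \<Sum>l\<in>I. ?x j * cnj (?x l) * P j l) = P i i"
        by (simp only: delta)
      have c: "cnj s * P i r = - of_real (\<bar>q\<bar> + 1)"
      proof -
        have "cnj s * P i r = - of_real ((\<bar>q\<bar> + 1) / (cmod (P i r))\<^sup>2) * (P i r * cnj (P i r))"
          by (simp add: s_def)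
        also have "\<dots> = - of_real ((\<bar>q\<bar> + 1) / (cmod (P i r))\<^sup>2 * (cmod (P i r))\<^sup>2)"
          by (simp only: complex_norm_square[symmetric] of_real_mult mult_minus_left)
        finally show ?thesis using nz by simp
      qed
      from form'[of s ?x] show False unfolding a b c using True q_def by simp
    qed
    obtain p where p: "\<forall>i\<in>I. \<forall>j\<in>I. P i j = (\<Sum>m\<in>I. p m i * cnj (p m j))"
      using insert.IH[OF psdI] by blast
    let ?p = "\<lambda>m i. if m = r \<or> i = r then 0 else p m i"
    have "P i j = (\<Sum>m\<in>insert r I. ?p m i * cnj (?p m j))" if ij: "i \<in> insert r I" "j \<in> insert r I" for i j
    proof (cases "i = r \<or> j = r")
      case c: True
      have col: "P l r = 0" if "l \<in> insert r I" for l using that zero Prr True by auto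
      have "P i j = 0"
        using c col[OF ij(1)] col[OF ij(2)] herm[OF ij(2,1)] by (metis complex_cnj_zero)
      moreover have "(\<Sum>m\<in>insert r I. ?p m i * cnj (?p m j)) = 0" using c by (intro sum.neutral) auto
      ultimately show ?thesis by simp
    next
      case False
      have "(\<Sum>m\<in>insert r I. ?p m i * cnj (?p m j)) = (\<Sum>m\<in>I. p m i * cnj (p m j))"
        using fin r False by (auto intro!: sum.cong)
      moreover have "P i j = (\<Sum>m\<in>I. p m i * cnj (p m j))"
        using p False ij by blast
      ultimately show ?thesis by (simp only:)
    qed
    then have "\<forall>i\<in>insert r I. \<forall>j\<in>insert r I. P i j = (\<Sum>m\<in>insert r I. ?p m i * cnj (?p m j))"
      by (intro ballI)
    then show ?thesis by (rule exI[of _ ?p])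
  next
    case False
    with d0 have d: "d > 0" by simp
    define P' where "P' i j = P i j - P i r * cnj (P j r) / of_real d" for i j
    have psdI': "psd I P'"
      unfolding psd_def
    proof (intro conjI allI ballI)
      fix i j assume "i \<in> I" "j \<in> I"
      then show "P' j i = cnj (P' i j)" using herm[of i j] by (simp add: P'_def)
    next
      fix \<xi> :: "'i \<Rightarrow> complex"
      define w where "w = (\<Sum>i\<in>I. \<xi> i * P i r)"
      have "(\<Sum>i\<in>I. \<Sum>j\<in>I. \<xi> i * cnj (\<xi> j) * P' i j) =
         (\<Sum>i\<in>I. \<Sum>j\<in>I. \<xi> i * cnj (\<xi> j) * P i j) - w * cnj w / of_real d"
        by (simp add: P'_def w_def right_diff_distrib sum_subtractf sum_product sum_divide_distrib mult_ac)
      also have "\<dots> = (\<Sum>i\<in>I. \<Sum>j\<in>I. \<xi> i * cnj (\<xi> j) * P i j) - of_real ((cmod w)\<^sup>2 / d)"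
        by (simp only: complex_norm_square of_real_divide)
      finally have 1: "Re (\<Sum>i\<in>I. \<Sum>j\<in>I. \<xi> i * cnj (\<xi> j) * P' i j) =
          Re (\<Sum>i\<in>I. \<Sum>j\<in>I. \<xi> i * cnj (\<xi> j) * P i j) - (cmod w)\<^sup>2 / d"
        by simp
      have 2: "(cmod (- w / of_real d))\<^sup>2 * d = (cmod w)\<^sup>2 / d"
        using d by (simp add: norm_divide power2_eq_square)
      have 3: "Re (cnj (- w / of_real d) * w) = - (cmod w)\<^sup>2 / d"
      proof -
        have "cnj (- w / of_real d) * w = of_real (- (cmod w)\<^sup>2 / d)"
        proof -
          have "cnj (- w / of_real d) * w = - (w * cnj w) / of_real d" by simp
          then show ?thesis by (simp only: complex_norm_square[symmetric] of_real_divide of_real_minus)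
        qed
        then show ?thesis by (simp only: Re_complex_of_real)
      qed
      show "0 \<le> Re (\<Sum>i\<in>I. \<Sum>j\<in>I. \<xi> i * cnj (\<xi> j) * P' i j)"
        \<comment> \<open>The minimiser over the coordinate at \<open>r\<close> turns the form of \<open>P\<close> into that of the Schur complement.\<close>
        using form'[of "- w / of_real d" \<xi>] unfolding w_def[symmetric] 1 2 3 by simp
    qed
    obtain p where p: "\<forall>i\<in>I. \<forall>j\<in>I. P' i j = (\<Sum>m\<in>I. p m i * cnj (p m j))"
      using insert.IH[OF psdI'] by blast
    let ?p = "\<lambda>m i. if m = r then P i r / of_real (sqrt d) else if i = r then 0 else p m i"
    have "P i j = (\<Sum>m\<in>insert r I. ?p m i * cnj (?p m j))" if ij: "i \<in> insert r I" "j \<in> insert r I" for i j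
    proof -
      have sq: "of_real (sqrt d) * of_real (sqrt d) = (of_real d :: complex)"
        using d by (simp flip: of_real_mult)
      have "(\<Sum>m\<in>insert r I. ?p m i * cnj (?p m j)) =
        P i r * cnj (P j r) / of_real d + (\<Sum>m\<in>I. ?p m i * cnj (?p m j))"
        using fin r by (simp add: sq)
      moreover have "(\<Sum>m\<in>I. ?p m i * cnj (?p m j)) = (if i = r \<or> j = r then 0 else P' i j)"
      proof (cases "i = r \<or> j = r")
        case False
        then have "(\<Sum>m\<in>I. ?p m i * cnj (?p m j)) = (\<Sum>m\<in>I. p m i * cnj (p m j))"
          by (intro sum.cong) (use r in auto)
        moreover have "P' i j = (\<Sum>m\<in>I. p m i * cnj (p m j))"
          using p False ij by blast
        ultimately show ?thesis using False by (simp only: if_False)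
      next
        case True
        have "(\<Sum>m\<in>I. ?p m i * cnj (?p m j)) = 0"
        proof (rule sum.neutral, rule ballI)
          fix m assume "m \<in> I"
          then have "m \<noteq> r" using r by auto
          then show "?p m i * cnj (?p m j) = 0" using True by auto
        qed
        then show ?thesis using True by (simp only: if_True)
      qed
      ultimately have eq: "(\<Sum>m\<in>insert r I. ?p m i * cnj (?p m j)) =
          P i r * cnj (P j r) / of_real d + (if i = r \<or> j = r then 0 else P' i j)" by simp
      show ?thesis
      proof (cases "i = r \<or> j = r")
        case True
        then show ?thesis
        proof
          assume "i = r"
          moreover have "P r j = cnj (P j r)" by (rule herm) (use ij in auto)
          ultimately show ?thesis unfolding eq using Prr d by simp
        next
          assume "j = r"
          then show ?thesis unfolding eq using Prr d by simp
        qed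
      next
        case False then show ?thesis unfolding eq by (simp add: P'_def)
      qed
    qed
    then have "\<forall>i\<in>insert r I. \<forall>j\<in>insert r I. P i j = (\<Sum>m\<in>insert r I. ?p m i * cnj (?p m j))"
      by (intro ballI)
    then show ?thesis by (rule exI[of _ ?p])
  qed
qed

text \<open>Factoring one matrix turns the sum of the entries of the Schur product into a sum of values of the
  quadratic form of the other.\<close>

lemma schur_product_nonneg:
  assumes "finite I" "psd I P" "psd I Q"
  shows "0 \<le> Re (\<Sum>i\<in>I. \<Sum>j\<in>I. Q i j * P i j)"
proof -
  obtain p where p: "\<And>i j. i \<in> I \<Longrightarrow> j \<in> I \<Longrightarrow> P i j = (\<Sum>m\<in>I. p m i * cnj (p m j))"
    using psd_factorization[OF assms(1,2)] by blast
  have "(\<Sum>i\<in>I. \<Sum>j\<in>I. Q i j * P i j) = (\<Sum>i\<in>I. \<Sum>j\<in>I. \<Sum>m\<in>I. p m i * cnj (p m j) * Q i j)"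
    by (intro sum.cong refl) (simp add: p sum_distrib_left mult_ac)
  also have "\<dots> = (\<Sum>i\<in>I. \<Sum>m\<in>I. \<Sum>j\<in>I. p m i * cnj (p m j) * Q i j)"
    by (intro sum.cong refl sum.swap)
  also have "\<dots> = (\<Sum>m\<in>I. \<Sum>i\<in>I. \<Sum>j\<in>I. p m i * cnj (p m j) * Q i j)"
    by (rule sum.swap)
  finally have "Re (\<Sum>i\<in>I. \<Sum>j\<in>I. Q i j * P i j) = (\<Sum>m\<in>I. Re (\<Sum>i\<in>I. \<Sum>j\<in>I. p m i * cnj (p m j) * Q i j))"
    by simp
  also have "\<dots> \<ge> 0" by (intro sum_nonneg psd_nonneg assms)
  finally show ?thesis .
qed

section \<open>Complex inner products, bounded operators and scalar matrices\<close>

lemma cinner_add_right: "cinner x (y + z) = cinner x y + cinner x (z :: 'a::complex_inner)"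
  by (metis cinner_add_left cinner_commute complex_cnj_add)

lemma cinner_zero_left [simp]: "cinner 0 (x :: 'a::complex_inner) = 0"
  using cinner_add_left[of 0 0 x] by simp

lemma cinner_zero_right [simp]: "cinner (x :: 'a::complex_inner) 0 = 0"
  using cinner_add_right[of x 0 0] by simp

lemma cinner_sum_left: "cinner (\<Sum>i\<in>I. f i) (x :: 'a::complex_inner) = (\<Sum>i\<in>I. cinner (f i) x)"
  by (induction I rule: infinite_finite_induct) (simp_all add: cinner_add_left)

lemma cinner_sum_right: "cinner (x :: 'a::complex_inner) (\<Sum>i\<in>I. f i) = (\<Sum>i\<in>I. cinner x (f i))"
  by (induction I rule: infinite_finite_induct) (simp_all add: cinner_add_right)

lemma cinner_sum_list_left:
  "cinner (\<Sum>i\<leftarrow>xs. f i) (x :: 'a::complex_inner) = (\<Sum>i\<leftarrow>xs. cinner (f i) x)"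
  by (induction xs) (simp_all add: cinner_add_left)

lemma cinner_sum_list_right:
  "cinner (x :: 'a::complex_inner) (\<Sum>i\<leftarrow>xs. f i) = (\<Sum>i\<leftarrow>xs. cinner x (f i))"
  by (induction xs) (simp_all add: cinner_add_right)

lemma norm_sum_scaleC:
  "of_real ((norm (\<Sum>p\<in>I. \<xi> p *\<^sub>C (Y p :: 'a::complex_inner)))\<^sup>2)
     = (\<Sum>p\<in>I. \<Sum>q\<in>I. \<xi> p * cnj (\<xi> q) * cinner (Y p) (Y q))"
  unfolding cinner_self[symmetric] cinner_sum_left cinner_scaleC_left
  unfolding cinner_sum_right cinner_scaleC_right
  by (simp add: sum_distrib_left mult.assoc)

lemma psd_gram: "psd I (\<lambda>p q. cinner (Y p) (Y q :: 'a::complex_inner))"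
  unfolding psd_def
proof (intro conjI ballI allI)
  fix p q show "cinner (Y q) (Y p) = cnj (cinner (Y p) (Y q))" by (rule cinner_commute)
next
  fix \<xi> :: "_ \<Rightarrow> complex"
  show "0 \<le> Re (\<Sum>p\<in>I. \<Sum>q\<in>I. \<xi> p * cnj (\<xi> q) * cinner (Y p) (Y q))"
    unfolding norm_sum_scaleC[symmetric] by (simp only: Re_complex_of_real zero_le_power2)
qed

text \<open>A norm inequality between two linear images of the coefficients is the positivity of a
  difference of Gram matrices. This is the form in which operator bounds enter the Schur product theorem.\<close>

lemma psd_gram_diff:
  fixes Y Z :: "'i \<Rightarrow> nat \<Rightarrow> 'a::complex_inner"
  assumes "\<And>\<xi>. (\<Sum>j<l. (norm (\<Sum>p\<in>I. \<xi> p *\<^sub>C Z p j))\<^sup>2) \<le> M * (\<Sum>j<k. (norm (\<Sum>p\<in>I. \<xi> p *\<^sub>C Y p j))\<^sup>2)"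
  shows "psd I (\<lambda>p q. of_real M * (\<Sum>j<k. cinner (Y p j) (Y q j)) - (\<Sum>j<l. cinner (Z p j) (Z q j)))"
  unfolding psd_def
proof (intro conjI ballI allI)
  fix p q
  have "cnj (\<Sum>j<n. cinner (X p j) (X q j)) = (\<Sum>j<n. cinner (X q j) (X p j))"
    for n and X :: "'i \<Rightarrow> nat \<Rightarrow> 'a"
    unfolding cnj_sum by (rule sum.cong[OF refl]) (rule cinner_commute[symmetric])
  then show "of_real M * (\<Sum>j<k. cinner (Y q j) (Y p j)) - (\<Sum>j<l. cinner (Z q j) (Z p j)) =
      cnj (of_real M * (\<Sum>j<k. cinner (Y p j) (Y q j)) - (\<Sum>j<l. cinner (Z p j) (Z q j)))"
    by (simp only: complex_cnj_diff complex_cnj_mult complex_cnj_complex_of_real)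
next
  fix \<xi> :: "'i \<Rightarrow> complex"
  have *: "(\<Sum>p\<in>I. \<Sum>q\<in>I. \<xi> p * cnj (\<xi> q) * (\<Sum>j<n. cinner (X p j) (X q j)))
     = of_real (\<Sum>j<n. (norm (\<Sum>p\<in>I. \<xi> p *\<^sub>C X p j))\<^sup>2)" for n and X :: "'i \<Rightarrow> nat \<Rightarrow> 'a"
  proof -
    have "(\<Sum>p\<in>I. \<Sum>q\<in>I. \<xi> p * cnj (\<xi> q) * (\<Sum>j<n. cinner (X p j) (X q j)))
       = (\<Sum>p\<in>I. \<Sum>q\<in>I. \<Sum>j<n. \<xi> p * cnj (\<xi> q) * cinner (X p j) (X q j))"
      by (simp only: sum_distrib_left)
    also have "\<dots> = (\<Sum>p\<in>I. \<Sum>j<n. \<Sum>q\<in>I. \<xi> p * cnj (\<xi> q) * cinner (X p j) (X q j))"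
      by (rule sum.cong[OF refl], rule sum.swap)
    also have "\<dots> = (\<Sum>j<n. \<Sum>p\<in>I. \<Sum>q\<in>I. \<xi> p * cnj (\<xi> q) * cinner (X p j) (X q j))"
      by (rule sum.swap)
    finally show ?thesis by (simp only: norm_sum_scaleC[symmetric] of_real_sum)
  qed
  have "(\<Sum>p\<in>I. \<Sum>q\<in>I. \<xi> p * cnj (\<xi> q) *
        (of_real M * (\<Sum>j<k. cinner (Y p j) (Y q j)) - (\<Sum>j<l. cinner (Z p j) (Z q j))))
     = of_real M * (\<Sum>p\<in>I. \<Sum>q\<in>I. \<xi> p * cnj (\<xi> q) * (\<Sum>j<k. cinner (Y p j) (Y q j)))
       - (\<Sum>p\<in>I. \<Sum>q\<in>I. \<xi> p * cnj (\<xi> q) * (\<Sum>j<l. cinner (Z p j) (Z q j)))"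
    unfolding sum_distrib_left[of "of_real M" _ I] sum_subtractf[symmetric]
    by (intro sum.cong refl) (simp only: right_diff_distrib mult.left_commute)
  also have "\<dots> = of_real (M * (\<Sum>j<k. (norm (\<Sum>p\<in>I. \<xi> p *\<^sub>C Y p j))\<^sup>2)
       - (\<Sum>j<l. (norm (\<Sum>p\<in>I. \<xi> p *\<^sub>C Z p j))\<^sup>2))"
    unfolding * by (simp only: of_real_diff of_real_mult)
  finally show "0 \<le> Re (\<Sum>p\<in>I. \<Sum>q\<in>I. \<xi> p * cnj (\<xi> q) *
        (of_real M * (\<Sum>j<k. cinner (Y p j) (Y q j)) - (\<Sum>j<l. cinner (Z p j) (Z q j))))"
    using assms[of \<xi>] by (simp only: Re_complex_of_real)
qed

lemma scaleC_zero_left [simp]: "0 *\<^sub>C (x :: 'a::complex_vector) = 0"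
  by (rule complex_vector.scale_zero_left)

lemma bounded_clinearI:
  fixes f :: "'a::complex_normed_vector \<Rightarrow> 'b::complex_normed_vector"
  assumes "\<And>x y. f (x + y) = f x + f y" "\<And>c x. f (c *\<^sub>C x) = c *\<^sub>C f x" "\<And>x. norm (f x) \<le> norm x * K"
  shows "bounded_clinear f"
  unfolding bounded_clinear_def
  by (intro conjI allI bounded_linear_intro[of _ K] assms) (simp only: scaleR_scaleC assms)

lemma bounded_clinearD:
  assumes "bounded_clinear f"
  shows bounded_clinear_bounded_linear: "bounded_linear f"
    and bounded_clinear_add: "f (x + y) = f x + f y"
    and bounded_clinear_diff: "f (x - y) = f x - f y"
    and bounded_clinear_zero: "f 0 = 0"
    and bounded_clinear_scaleC: "f (c *\<^sub>C x) = c *\<^sub>C f x"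
    and bounded_clinear_sum: "f (\<Sum>i\<in>I. h i) = (\<Sum>i\<in>I. f (h i))"
    and bounded_clinear_sum_list: "f (\<Sum>i\<leftarrow>xs. g i) = (\<Sum>i\<leftarrow>xs. f (g i))"
    and bounded_clinear_norm: "norm (f x) \<le> onorm f * norm x"
proof -
  show b: "bounded_linear f" and "f (c *\<^sub>C x) = c *\<^sub>C f x"
    using assms by (simp_all add: bounded_clinear_def)
  then interpret bounded_linear f by simp
  show "f (x + y) = f x + f y" "f (x - y) = f x - f y" "f 0 = 0" "f (\<Sum>i\<in>I. h i) = (\<Sum>i\<in>I. f (h i))"
    by (simp_all add: add diff zero sum)
  show "f (\<Sum>i\<leftarrow>xs. g i) = (\<Sum>i\<leftarrow>xs. f (g i))"
    by (induction xs) (simp_all add: add zero)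
  show "norm (f x) \<le> onorm f * norm x"
    by (rule onorm[OF b])
qed

lemma bounded_clinear_plus:
  assumes "bounded_clinear f" "bounded_clinear g" shows "bounded_clinear (\<lambda>x. f x + g x)"
  using assms by (auto simp: bounded_clinear_def scaleC_add_right intro: bounded_linear_add)

lemma bounded_clinear_scale:
  fixes f :: "'a::complex_normed_vector \<Rightarrow> 'b::complex_normed_vector"
  assumes "bounded_clinear f" shows "bounded_clinear (\<lambda>x. c *\<^sub>C f x)"
proof (rule bounded_clinearI)
  fix x
  have "norm (c *\<^sub>C f x) \<le> cmod c * (onorm f * norm x)"
    unfolding norm_scaleC by (intro mult_left_mono bounded_clinear_norm[OF assms]) simp
  then show "norm (c *\<^sub>C f x) \<le> norm x * (cmod c * onorm f)" by (simp add: mult_ac)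
qed (simp_all add: bounded_clinearD[OF assms] scaleC_add_right scaleC_scaleC mult.commute)

lemma bounded_clinear_id: "bounded_clinear (\<lambda>x. x)" "bounded_clinear id"
  by (simp_all add: bounded_clinear_def bounded_linear_ident id_def)

text \<open>Amplifying a scalar matrix from \<open>\<complex>\<close> to a Hilbert space does not change its norm: the defect
  \<open>M - V\<^sup>*V\<close> and the Gram matrix of the vectors \<open>x\<close> are positive semidefinite, and the difference of the two sides
  is the sum of the entries of their Schur product.\<close>

lemma scalar_matrix_amplification:
  fixes x :: "nat \<Rightarrow> 'h::complex_inner"
  assumes "\<And>\<xi>. (\<Sum>i<k. (cmod (\<Sum>j<k. V i j * \<xi> j))\<^sup>2) \<le> M * (\<Sum>j<k. (cmod (\<xi> j))\<^sup>2)"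
  shows "(\<Sum>i<k. (norm (\<Sum>j<k. V i j *\<^sub>C x j))\<^sup>2) \<le> M * (\<Sum>j<k. (norm (x j))\<^sup>2)"
proof -
  define e :: "nat \<Rightarrow> nat \<Rightarrow> complex" where "e p j = (if j = p then 1 else 0)" for p j
  define Q where "Q p q = of_real M * (\<Sum>j<k. cinner (e p j) (e q j)) - (\<Sum>i<k. cinner (V i p) (V i q))" for p q
  have e: "(\<Sum>p<k. \<xi> p *\<^sub>C e p j) = \<xi> j" if "j < k" for \<xi> j
  proof -
    have "(\<Sum>p<k. \<xi> p *\<^sub>C e p j) = (\<Sum>p<k. if p = j then \<xi> p else 0)"
      by (rule sum.cong) (auto simp: e_def scaleC_complex_def)
    then show ?thesis using that by simp
  qed
  have "psd {..<k} Q"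
    unfolding Q_def
  proof (rule psd_gram_diff)
    fix \<xi> :: "nat \<Rightarrow> complex"
    have "(\<Sum>i<k. (norm (\<Sum>p<k. \<xi> p *\<^sub>C V i p))\<^sup>2) \<le> M * (\<Sum>j<k. (cmod (\<xi> j))\<^sup>2)"
      using assms[of \<xi>] by (simp only: scaleC_complex_def mult.commute[of "\<xi> _"])
    also have "(\<Sum>j<k. (cmod (\<xi> j))\<^sup>2) = (\<Sum>j<k. (norm (\<Sum>p<k. \<xi> p *\<^sub>C e p j))\<^sup>2)"
      by (rule sum.cong) (auto simp: e)
    finally show "(\<Sum>i<k. (norm (\<Sum>p<k. \<xi> p *\<^sub>C V i p))\<^sup>2) \<le> M * (\<Sum>j<k. (norm (\<Sum>p<k. \<xi> p *\<^sub>C e p j))\<^sup>2)" .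
  qed
  then have 1: "0 \<le> Re (\<Sum>p<k. \<Sum>q<k. Q p q * cinner (x p) (x q))"
    by (rule schur_product_nonneg[OF finite_lessThan psd_gram])
  have Q: "Q p q = (if p = q then of_real M else 0) - (\<Sum>i<k. V i p * cnj (V i q))"
    if "p < k" for p q
  proof -
    have "(\<Sum>j<k. cinner (e p j) (e q j)) = (\<Sum>j<k. if j = p then cinner (e p p) (e q p) else 0)"
      by (rule sum.cong) (auto simp: e_def)
    then show ?thesis using that by (auto simp: Q_def cinner_complex_def e_def)
  qed
  have "(\<Sum>p<k. \<Sum>q<k. Q p q * cinner (x p) (x q)) =
      (\<Sum>p<k. \<Sum>q<k. (if p = q then of_real M * cinner (x p) (x q) else 0)
         - (\<Sum>i<k. V i p * cnj (V i q) * cinner (x p) (x q)))"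
    by (intro sum.cong refl) (auto simp: Q left_diff_distrib sum_distrib_right)
  also have "\<dots> = (\<Sum>p<k. of_real M * cinner (x p) (x p))
       - (\<Sum>p<k. \<Sum>q<k. \<Sum>i<k. V i p * cnj (V i q) * cinner (x p) (x q))"
    by (simp add: sum_subtractf)
  also have "(\<Sum>p<k. \<Sum>q<k. \<Sum>i<k. V i p * cnj (V i q) * cinner (x p) (x q))
      = (\<Sum>p<k. \<Sum>i<k. \<Sum>q<k. V i p * cnj (V i q) * cinner (x p) (x q))"
    by (rule sum.cong[OF refl], rule sum.swap)
  also have "\<dots> = (\<Sum>i<k. \<Sum>p<k. \<Sum>q<k. V i p * cnj (V i q) * cinner (x p) (x q))"
    by (rule sum.swap)
  also have "\<dots> = of_real (\<Sum>i<k. (norm (\<Sum>j<k. V i j *\<^sub>C x j))\<^sup>2)"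
    by (simp only: norm_sum_scaleC[symmetric] of_real_sum)
  also have "(\<Sum>p<k. of_real M * cinner (x p) (x p)) = of_real (M * (\<Sum>j<k. (norm (x j))\<^sup>2))"
    by (simp only: cinner_self of_real_mult of_real_sum sum_distrib_left)
  finally have "(\<Sum>p<k. \<Sum>q<k. Q p q * cinner (x p) (x q)) =
     of_real (M * (\<Sum>j<k. (norm (x j))\<^sup>2) - (\<Sum>i<k. (norm (\<Sum>j<k. V i j *\<^sub>C x j))\<^sup>2))"
    by (simp only: of_real_diff)
  with 1 show ?thesis by (simp only: Re_complex_of_real)
qed

text \<open>A contraction given on a dense set of values of formal expressions extends to the whole space. Working
  with expressions \<open>d\<close> and their values \<open>S d\<close> makes well-definedness part of the norm inequality: expressions of equal
  value have equal images.\<close>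

lemma extend_contraction:
  fixes S R :: "'d \<Rightarrow> 'k::complex_hilbert_space"
  assumes dense: "closure (range S) = UNIV"
    and le: "\<And>d e. norm (R d - R e) \<le> norm (S d - S e)"
    and add: "\<And>d e. \<exists>f. S f = S d + S e \<and> R f = R d + R e"
    and scale: "\<And>c d. \<exists>f. S f = c *\<^sub>C S d \<and> R f = c *\<^sub>C R d"
  shows "\<exists>F. bounded_clinear F \<and> (\<forall>d. F (S d) = R d) \<and> (\<forall>x. norm (F x) \<le> norm x)"
proof -
  have "\<exists>d. (\<lambda>n. S (d n)) \<longlonglongrightarrow> x" for x
  proof -
    have "x \<in> closure (range S)" using dense by simp
    then obtain s where s: "\<And>n. s n \<in> range S" "s \<longlonglongrightarrow> x" unfolding closure_sequential by blast
    then have "\<forall>n. \<exists>d. s n = S d" by blast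
    then obtain d where "\<forall>n. s n = S (d n)" by metis
    then have "s = (\<lambda>n. S (d n))" by auto
    then show ?thesis using s(2) by blast
  qed
  then obtain d where d: "\<And>x. (\<lambda>n. S (d x n)) \<longlonglongrightarrow> x" by metis
  have conv: "convergent (\<lambda>n. R (e n))" if "(\<lambda>n. S (e n)) \<longlonglongrightarrow> x" for e x
  proof -
    have "Cauchy (\<lambda>n. S (e n))" using that by (intro convergent_Cauchy convergentI)
    then have "Cauchy (\<lambda>n. R (e n))"
      unfolding Cauchy_def dist_norm using le order_le_less_trans by metis
    then show ?thesis by (simp add: Cauchy_convergent_iff)
  qed
  define F where "F x = lim (\<lambda>n. R (d x n))" for x
  have F: "(\<lambda>n. R (e n)) \<longlonglongrightarrow> F x" if "(\<lambda>n. S (e n)) \<longlonglongrightarrow> x" for e x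
  proof -
    have *: "(\<lambda>n. R (d x n)) \<longlonglongrightarrow> F x"
      using conv[OF d] unfolding F_def by (simp add: convergent_LIMSEQ_iff)
    have "(\<lambda>n. S (e n) - S (d x n)) \<longlonglongrightarrow> x - x" by (intro tendsto_diff that d)
    then have "(\<lambda>n. S (e n) - S (d x n)) \<longlonglongrightarrow> 0" by simp
    then have "(\<lambda>n. R (e n) - R (d x n)) \<longlonglongrightarrow> 0"
      by (rule Lim_null_comparison[OF _ tendsto_norm_zero, rotated]) (simp add: le)
    from tendsto_add[OF this *] show ?thesis by simp
  qed
  have FS: "F (S e) = R e" for e
    using F[of "\<lambda>_. e", OF tendsto_const] by (simp add: LIMSEQ_const_iff)
  have Fadd: "F (x + y) = F x + F y" for x y
  proof -
    obtain e where e: "\<And>n. S (e n) = S (d x n) + S (d y n)" "\<And>n. R (e n) = R (d x n) + R (d y n)"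
      using choice[of "\<lambda>n f. S f = S (d x n) + S (d y n) \<and> R f = R (d x n) + R (d y n)"] add by blast
    have "(\<lambda>n. S (e n)) \<longlonglongrightarrow> x + y" unfolding e by (intro tendsto_add d)
    from F[OF this] have "(\<lambda>n. R (d x n) + R (d y n)) \<longlonglongrightarrow> F (x + y)" unfolding e .
    moreover have "(\<lambda>n. R (d x n) + R (d y n)) \<longlonglongrightarrow> F x + F y" by (intro tendsto_add F d)
    ultimately show ?thesis by (rule LIMSEQ_unique)
  qed
  have sc: "(\<lambda>n. c *\<^sub>C s n) \<longlonglongrightarrow> c *\<^sub>C y" if "s \<longlonglongrightarrow> y" for s and y :: 'k and c
    using bounded_linear.tendsto[OF bounded_clinear_bounded_linear[OF bounded_clinear_scale[OF bounded_clinear_id(1)]] that] .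
  have Fscale: "F (c *\<^sub>C x) = c *\<^sub>C F x" for c x
  proof -
    obtain e where e: "\<And>n. S (e n) = c *\<^sub>C S (d x n)" "\<And>n. R (e n) = c *\<^sub>C R (d x n)"
      using choice[of "\<lambda>n f. S f = c *\<^sub>C S (d x n) \<and> R f = c *\<^sub>C R (d x n)"] scale by blast
    have "(\<lambda>n. S (e n)) \<longlonglongrightarrow> c *\<^sub>C x" unfolding e by (intro sc d)
    from F[OF this] have "(\<lambda>n. c *\<^sub>C R (d x n)) \<longlonglongrightarrow> F (c *\<^sub>C x)" unfolding e .
    moreover have "(\<lambda>n. c *\<^sub>C R (d x n)) \<longlonglongrightarrow> c *\<^sub>C F x" by (intro sc F d)
    ultimately show ?thesis by (rule LIMSEQ_unique)
  qed
  obtain z where z: "S z = 0" "R z = 0" using scale[of 0 undefined] by auto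
  have "norm (R e) \<le> norm (S e)" for e using le[of e z] z by simp
  then have Fn: "norm (F x) \<le> norm x" for x
    by (intro LIMSEQ_le[OF tendsto_norm[OF F[OF d]] tendsto_norm[OF d]]) blast
  then have "bounded_clinear F"
    by (intro bounded_clinearI[of _ 1] Fadd Fscale) simp
  with FS Fn show ?thesis by blast
qed

section \<open>Operators on one tensor factor\<close>

lemma norm_sum_gram:
  "of_real ((norm (\<Sum>p\<in>I. Y p :: 'a::complex_inner))\<^sup>2) = (\<Sum>p\<in>I. \<Sum>q\<in>I. cinner (Y p) (Y q))"
  unfolding cinner_self[symmetric] cinner_sum_left unfolding cinner_sum_right ..

lemma norm_sum_gram_family:
  "of_real (\<Sum>j<n. (norm (\<Sum>p\<in>I. Y p j :: 'a::complex_inner))\<^sup>2)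
     = (\<Sum>p\<in>I. \<Sum>q\<in>I. \<Sum>j<n. cinner (Y p j) (Y q j))"
proof -
  have "(\<Sum>p\<in>I. \<Sum>q\<in>I. \<Sum>j<n. cinner (Y p j) (Y q j)) = (\<Sum>p\<in>I. \<Sum>j<n. \<Sum>q\<in>I. cinner (Y p j) (Y q j))"
    by (rule sum.cong[OF refl], rule sum.swap)
  also have "\<dots> = (\<Sum>j<n. \<Sum>p\<in>I. \<Sum>q\<in>I. cinner (Y p j) (Y q j))" by (rule sum.swap)
  finally show ?thesis by (simp only: norm_sum_gram of_real_sum)
qed

text \<open>The form \<open>\<langle>c, c'\<rangle> - \<langle>T c, T c'\<rangle>\<close> replaces the square of the defect operator \<open>(I - T\<^sup>*T)\<^bsup>1/2\<^esup>\<close>.\<close>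

lemma psd_contraction_defect:
  fixes T :: "'c::complex_inner \<Rightarrow> 'c"
  assumes "bounded_clinear T" "\<And>c. norm (T c) \<le> norm c"
  shows "psd I (\<lambda>p q. cinner (c p) (c q) - cinner (T (c p)) (T (c q)))"
proof -
  have "psd I (\<lambda>p q. of_real 1 * (\<Sum>j<1::nat. cinner (c p) (c q)) - (\<Sum>j<1::nat. cinner (T (c p)) (T (c q))))"
  proof (rule psd_gram_diff)
    fix \<xi>
    have "(\<Sum>p\<in>I. \<xi> p *\<^sub>C T (c p)) = T (\<Sum>p\<in>I. \<xi> p *\<^sub>C c p)"
      by (simp add: bounded_clinearD[OF assms(1)])
    then show "(\<Sum>j<1::nat. (norm (\<Sum>p\<in>I. \<xi> p *\<^sub>C T (c p)))\<^sup>2) \<le> 1 * (\<Sum>j<1::nat. (norm (\<Sum>p\<in>I. \<xi> p *\<^sub>C c p))\<^sup>2)"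
      using power_mono[OF assms(2) norm_ge_zero] by simp
  qed
  then show ?thesis by simp
qed

lemma tensor_linear:
  assumes "hilbert_tensor3 t"
  shows "t (a + a') b c = t a b c + t a' b c" "t (s *\<^sub>C a) b c = s *\<^sub>C t a b c"
    "t a (b + b') c = t a b c + t a b' c" "t a (s *\<^sub>C b) c = s *\<^sub>C t a b c"
    "t a b (c + c') = t a b c + t a b c'" "t a b (s *\<^sub>C c) = s *\<^sub>C t a b c"
  using assms unfolding hilbert_tensor3_def Vector_Spaces.linear_iff by simp_all

lemma tensor_inner:
  assumes "hilbert_tensor3 t"
  shows "cinner (t a b c) (t a' b' c') = cinner a a' * cinner b b' * cinner c c'"
  using assms unfolding hilbert_tensor3_def by blast

lemma cinner_unit: "norm (h :: 'a::complex_inner) = 1 \<Longrightarrow> cinner h h = 1"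
  by (simp add: cinner_self)

text \<open>A fixed unit vector \<open>h\<close> in the third factor gives a copy of the tensor product of the other two
  factors, so that Gram matrices of elementary tensors become Schur products.\<close>

lemma tensor_inner_unit:
  assumes "hilbert_tensor3 t" "norm h = 1"
  shows "cinner (t a b c) (t a' b' c') = cinner (t a b h) (t a' b' h) * cinner c c'"
  unfolding tensor_inner[OF assms(1)] cinner_unit[OF assms(2)] by simp

lemma tensor_norm:
  assumes "hilbert_tensor3 t" shows "norm (t a b c) = norm a * norm b * norm c"
proof -
  have "complex_of_real ((norm (t a b c))\<^sup>2) = of_real ((norm a * norm b * norm c)\<^sup>2)"
    using tensor_inner[OF assms, of a b c a b c] unfolding cinner_self
    by (simp only: power_mult_distrib of_real_mult)
  then have "(norm (t a b c))\<^sup>2 = (norm a * norm b * norm c)\<^sup>2" by (simp only: of_real_eq_iff)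
  then show ?thesis by (rule power2_eq_imp_eq) simp_all
qed

definition tensor_sum :: "('a \<Rightarrow> 'b \<Rightarrow> 'c \<Rightarrow> 'k) \<Rightarrow> ('a \<times> 'b \<times> 'c) list \<Rightarrow> 'k::monoid_add" where
  "tensor_sum t ds = (\<Sum>(a, b, c)\<leftarrow>ds. t a b c)"

lemma tensor_sum_simps [simp]:
  "tensor_sum t [] = 0" "tensor_sum t ((a, b, c) # ds) = t a b c + tensor_sum t ds"
  "tensor_sum t (ds @ es) = tensor_sum t ds + tensor_sum t es"
  by (simp_all add: tensor_sum_def)

lemma tensor_sum_scale:
  assumes "hilbert_tensor3 t"
  shows "tensor_sum t (map (\<lambda>(a, b, c). (s *\<^sub>C a, b, c)) ds) = s *\<^sub>C tensor_sum t ds"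
  by (induction ds) (auto simp: tensor_linear[OF assms] scaleC_add_right complex_vector.scale_zero_right)

lemma closure_tensor_sums:
  assumes "hilbert_tensor3 t" shows "closure (range (tensor_sum t)) = UNIV"
proof -
  have "complex_vector.span {t x y z | x y z. True} \<subseteq> range (tensor_sum t)"
  proof
    fix x assume "x \<in> complex_vector.span {t x y z | x y z. True}"
    then show "x \<in> range (tensor_sum t)"
    proof (induction rule: complex_vector.span_induct_alt)
      case base show ?case by (rule image_eqI[of _ _ "[]"]) simp_all
    next
      case (step c x y)
      then obtain a b d ds where "x = t a b d" "y = tensor_sum t ds" by blast
      then have "c *\<^sub>C x + y = tensor_sum t ((c *\<^sub>C a, b, d) # ds)"
        by (simp add: tensor_linear[OF assms])
      then show ?case by (metis rangeI)
    qed
  qed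
  then have "closure (complex_vector.span {t x y z | x y z. True}) \<subseteq> closure (range (tensor_sum t))"
    by (rule closure_mono)
  then show ?thesis using assms unfolding hilbert_tensor3_def by auto
qed

lemma tensor_ext:
  assumes t: "hilbert_tensor3 t" and F: "bounded_clinear F" and G: "bounded_clinear G"
    and eq: "\<And>a b c. F (t a b c) = G (t a b c)"
  shows "F = G"
proof
  fix x
  have "closed {x. F x = G x}"
    using F G by (intro closed_Collect_eq linear_continuous_on bounded_clinear_bounded_linear)
  moreover have "range (tensor_sum t) \<subseteq> {x. F x = G x}"
  proof -
    have "F (tensor_sum t ds) = G (tensor_sum t ds)" for ds
      by (induction ds) (auto simp: bounded_clinearD[OF F] bounded_clinearD[OF G] eq)
    then show ?thesis by auto
  qed
  ultimately have "closure (range (tensor_sum t)) \<subseteq> {x. F x = G x}" by (rule closure_minimal[rotated])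
  then show "F x = G x" using closure_tensor_sums[OF t] by auto
qed

lemma tensor_sum_nth:
  "tensor_sum t ds = (\<Sum>l<length ds. t (fst (ds ! l)) (fst (snd (ds ! l))) (snd (snd (ds ! l))))"
  unfolding tensor_sum_def sum_list_sum_nth by (simp add: case_prod_beta atLeast0LessThan)

text \<open>Both sides are Schur products with the same Gram matrix of the first two factors, and the
  Gram matrices of the third factors differ by the positive semidefinite defect of \<open>T\<close>.\<close>

lemma tensor_sum_contraction:
  fixes t :: "'a::complex_hilbert_space \<Rightarrow> 'b::complex_hilbert_space
      \<Rightarrow> 'c::complex_hilbert_space \<Rightarrow> 'k::complex_hilbert_space"
    and h :: 'c
  assumes t: "hilbert_tensor3 t" and T: "bounded_clinear T" "\<And>c. norm (T c) \<le> norm c"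
    and h: "norm h = 1"
  shows "norm (tensor_sum (\<lambda>a b c. t a b (T c)) ds) \<le> norm (tensor_sum t ds)"
proof -
  define a b c where "a l = fst (ds ! l)" and "b l = fst (snd (ds ! l))" and "c l = snd (snd (ds ! l))" for l
  let ?I = "{..<length ds}"
  have "0 \<le> Re (\<Sum>p\<in>?I. \<Sum>q\<in>?I. cinner (t (a p) (b p) h) (t (a q) (b q) h) *
      (cinner (c p) (c q) - cinner (T (c p)) (T (c q))))"
    by (rule schur_product_nonneg[OF finite_lessThan psd_contraction_defect[OF T] psd_gram])
  also have "(\<Sum>p\<in>?I. \<Sum>q\<in>?I. cinner (t (a p) (b p) h) (t (a q) (b q) h) *
      (cinner (c p) (c q) - cinner (T (c p)) (T (c q)))) =
      of_real ((norm (\<Sum>p\<in>?I. t (a p) (b p) (c p)))\<^sup>2 - (norm (\<Sum>p\<in>?I. t (a p) (b p) (T (c p))))\<^sup>2)"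
    unfolding of_real_diff norm_sum_gram right_diff_distrib sum_subtractf
    by (simp only: tensor_inner_unit[OF t h, symmetric])
  also have "\<dots> = of_real ((norm (tensor_sum t ds))\<^sup>2 - (norm (tensor_sum (\<lambda>a b c. t a b (T c)) ds))\<^sup>2)"
    by (simp only: tensor_sum_nth a_def b_def c_def)
  finally show ?thesis by (simp only: Re_complex_of_real) (simp add: abs_le_square_iff[symmetric])
qed

lemma slot3_operator_exists:
  fixes t :: "'a::complex_hilbert_space \<Rightarrow> 'b::complex_hilbert_space
      \<Rightarrow> 'c::complex_hilbert_space \<Rightarrow> 'k::complex_hilbert_space"
    and h :: 'c
  assumes t: "hilbert_tensor3 t"
    and T: "bounded_clinear T" "\<And>c. norm (T c) \<le> norm c" and h: "norm h = 1"
  shows "\<exists>F. bounded_clinear F \<and> (\<forall>a b c. F (t a b c) = t a b (T c)) \<and> (\<forall>x. norm (F x) \<le> norm x)"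
proof -
  let ?R = "tensor_sum (\<lambda>a b c. t a b (T c))"
  have Rscale: "?R (map (\<lambda>(a, b, c). (s *\<^sub>C a, b, c)) ds) = s *\<^sub>C ?R ds" for s ds
    by (induction ds) (auto simp: tensor_linear[OF t] scaleC_add_right complex_vector.scale_zero_right)
  have neg: "(- 1) *\<^sub>C x = - x" for x :: 'k by (simp add: complex_vector.scale_minus_left scaleC_one)
  have "\<exists>F. bounded_clinear F \<and> (\<forall>ds. F (tensor_sum t ds) = ?R ds) \<and> (\<forall>x. norm (F x) \<le> norm x)"
  proof (rule extend_contraction)
    show "closure (range (tensor_sum t)) = UNIV" by (rule closure_tensor_sums[OF t])
    fix ds es
    have "norm (?R (ds @ map (\<lambda>(a, b, c). ((- 1) *\<^sub>C a, b, c)) es))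
        \<le> norm (tensor_sum t (ds @ map (\<lambda>(a, b, c). ((- 1) *\<^sub>C a, b, c)) es))"
      by (rule tensor_sum_contraction[OF t T h])
    then show "norm (?R ds - ?R es) \<le> norm (tensor_sum t ds - tensor_sum t es)"
      unfolding tensor_sum_simps Rscale tensor_sum_scale[OF t] neg by simp
    show "\<exists>fs. tensor_sum t fs = tensor_sum t ds + tensor_sum t es \<and> ?R fs = ?R ds + ?R es"
      by (rule exI[of _ "ds @ es"]) simp
    show "\<exists>fs. tensor_sum t fs = s *\<^sub>C tensor_sum t ds \<and> ?R fs = s *\<^sub>C ?R ds" for s
      by (rule exI[of _ "map (\<lambda>(a, b, c). (s *\<^sub>C a, b, c)) ds"]) (simp only: Rscale tensor_sum_scale[OF t])
  qed
  then obtain F where F: "bounded_clinear F" "\<And>ds. F (tensor_sum t ds) = ?R ds" "\<And>x. norm (F x) \<le> norm x"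
    by blast
  have "F (t a b c) = t a b (T c)" for a b c
    using F(2)[of "[(a, b, c)]"] by simp
  with F show ?thesis by blast
qed

text \<open>Operators of the form \<open>D \<otimes> I\<close>, where \<open>D\<close> maps elementary tensors of the first two factors to finite sums
  of such tensors. The list of these tensors may not depend on the vector in the third factor.\<close>

definition slot3_free :: "('a \<Rightarrow> 'b \<Rightarrow> 'c \<Rightarrow> 'k) \<Rightarrow> ('k \<Rightarrow> 'k::complex_normed_vector) \<Rightarrow> bool" where
  "slot3_free t G \<longleftrightarrow> bounded_clinear G \<and>
     (\<forall>a b. \<exists>ds. \<forall>c. G (t a b c) = (\<Sum>(a', b')\<leftarrow>ds. t a' b' c))"

lemma slot3_free_bounded: "slot3_free t G \<Longrightarrow> bounded_clinear G"
  by (simp add: slot3_free_def)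

lemma slot3_freeI:
  assumes "bounded_clinear G" "\<And>a b c. G (t a b c) = t (u a) (v b) c"
  shows "slot3_free t G"
  unfolding slot3_free_def
proof (intro conjI allI)
  fix a b
  show "\<exists>ds. \<forall>c. G (t a b c) = (\<Sum>(a', b')\<leftarrow>ds. t a' b' c)"
    by (rule exI[of _ "[(u a, v b)]"]) (simp add: assms)
qed fact

lemma slot3_free_plus:
  assumes "slot3_free t G" "slot3_free t H" shows "slot3_free t (\<lambda>x. G x + H x)"
  unfolding slot3_free_def
proof (intro conjI allI)
  show "bounded_clinear (\<lambda>x. G x + H x)"
    using assms by (intro bounded_clinear_plus slot3_free_bounded)
  fix a b
  obtain ds es where "\<And>c. G (t a b c) = (\<Sum>(a', b')\<leftarrow>ds. t a' b' c)" "\<And>c. H (t a b c) = (\<Sum>(a', b')\<leftarrow>es. t a' b' c)"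
    using assms unfolding slot3_free_def by meson
  then show "\<exists>ds. \<forall>c. G (t a b c) + H (t a b c) = (\<Sum>(a', b')\<leftarrow>ds. t a' b' c)"
    by (intro exI[of _ "ds @ es"]) simp
qed

lemma slot3_free_scale:
  assumes t: "hilbert_tensor3 t" and G: "slot3_free t G" shows "slot3_free t (\<lambda>x. s *\<^sub>C G x)"
  unfolding slot3_free_def
proof (intro conjI allI)
  show "bounded_clinear (\<lambda>x. s *\<^sub>C G x)"
    using G by (intro bounded_clinear_scale slot3_free_bounded)
  fix a b
  obtain ds where *: "\<And>c. G (t a b c) = (\<Sum>(a', b')\<leftarrow>ds. t a' b' c)"
    using G unfolding slot3_free_def by meson
  have "s *\<^sub>C (\<Sum>(a', b')\<leftarrow>ds. t a' b' c) = (\<Sum>(a', b')\<leftarrow>map (\<lambda>(a, b). (s *\<^sub>C a, b)) ds. t a' b' c)" for c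
    by (induction ds) (auto simp: tensor_linear[OF t] scaleC_add_right complex_vector.scale_zero_right)
  with * show "\<exists>ds. \<forall>c. s *\<^sub>C G (t a b c) = (\<Sum>(a', b')\<leftarrow>ds. t a' b' c)"
    by (intro exI[of _ "map (\<lambda>(a, b). (s *\<^sub>C a, b)) ds"]) simp
qed

lemma slot3_free_inner:
  assumes t: "hilbert_tensor3 t" and h: "norm h = 1" and G: "slot3_free t G" and H: "slot3_free t H"
  shows "cinner (G (t a b c)) (H (t a' b' c')) = cinner (G (t a b h)) (H (t a' b' h)) * cinner c c'"
proof -
  obtain ds where G: "\<And>c. G (t a b c) = (\<Sum>(a', b')\<leftarrow>ds. t a' b' c)"
    using G unfolding slot3_free_def by meson
  obtain es where H: "\<And>c. H (t a' b' c) = (\<Sum>(a', b')\<leftarrow>es. t a' b' c)"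
    using H unfolding slot3_free_def by meson
  show ?thesis
    unfolding G H cinner_sum_list_left cinner_sum_list_right sum_list_mult_const[symmetric]
    by (simp add: case_prod_beta cinner_sum_list_left cinner_sum_list_right sum_list_mult_const[symmetric]
        tensor_inner_unit[OF t h, of _ _ c _ _ c'])
qed

lemma slot3_free_commute:
  assumes t: "hilbert_tensor3 t" and F: "bounded_clinear F" "\<And>a b c. F (t a b c) = t a b (T c)"
    and G: "slot3_free t G"
  shows "F (G x) = G (F x)"
proof -
  have comp: "bounded_clinear (\<lambda>x. P (Q x))" if "bounded_clinear P" "bounded_clinear Q" for P Q :: "'d \<Rightarrow> 'd"
    using that unfolding bounded_clinear_def by (auto intro: bounded_linear_compose)
  have Gb: "bounded_clinear G" using G by (rule slot3_free_bounded)
  have "(\<lambda>x. F (G x)) = (\<lambda>x. G (F x))"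
  proof (rule tensor_ext[OF t comp[OF F(1) Gb] comp[OF Gb F(1)]])
    fix a b c
    obtain ds where G: "\<And>c. G (t a b c) = (\<Sum>(a', b')\<leftarrow>ds. t a' b' c)"
      using G unfolding slot3_free_def by meson
    show "F (G (t a b c)) = G (F (t a b c))"
      unfolding G F(2) by (simp add: bounded_clinear_sum_list[OF F(1)] case_prod_beta' F(2))
  qed
  then show ?thesis by meson
qed

section \<open>Matrices of operators and dilation by averaging\<close>

definition sum_norm_sq :: "nat \<Rightarrow> (nat \<Rightarrow> 'h::real_normed_vector) \<Rightarrow> real" where
  "sum_norm_sq k x = (\<Sum>j<k. (norm (x j))\<^sup>2)"

definition matrix_app :: "nat \<Rightarrow> (nat \<Rightarrow> nat \<Rightarrow> 'h \<Rightarrow> 'h) \<Rightarrow> (nat \<Rightarrow> 'h) \<Rightarrow> nat \<Rightarrow> 'h::real_normed_vector" where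
  "matrix_app k A x i = (\<Sum>j<k. A i j (x j))"

lemma sum_norm_sq_nonneg: "0 \<le> sum_norm_sq k x"
  by (simp add: sum_norm_sq_def sum_nonneg)

lemma roots_of_unity_orthogonal:
  assumes "n < L" "m < L"
  shows "(\<Sum>l<L. cis (2 * pi * real l / real L) ^ n * cnj (cis (2 * pi * real l / real L) ^ m))
     = (if n = m then of_nat L else 0)"
proof -
  define q where "q = cis (2 * pi * ((real n - real m) / real L))"
  have L: "real L > 0" using assms by simp
  have summand: "cis (2 * pi * real l / real L) ^ n * cnj (cis (2 * pi * real l / real L) ^ m) = q ^ l" for l
    unfolding q_def complex_cnj_power cis_cnj Complex.DeMoivre cis_mult
    by (rule arg_cong[of _ _ cis]) (use L in \<open>simp add: field_simps\<close>)
  have qL: "q ^ L = 1"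
  proof -
    have "q ^ L = cis (2 * pi * (real n - real m))"
      unfolding q_def Complex.DeMoivre by (rule arg_cong[of _ _ cis]) (use L in simp)
    then show ?thesis by (simp add: cis_multiple_2pi)
  qed
  have q1: "q \<noteq> 1" if "n \<noteq> m"
  proof
    assume "q = 1"
    then have "cos (2 * pi * ((real n - real m) / real L)) = 1" by (simp add: q_def complex_eq_iff)
    then obtain r :: int where "2 * pi * ((real n - real m) / real L) = of_int r * 2 * pi"
      using cos_one_2pi_int by (metis mult.assoc)
    then have "(real n - real m) / real L = of_int r"
      using mult_cancel_left[of "2 * pi" "(real n - real m) / real L" "of_int r"] by (simp add: mult_ac)
    then have "real n - real m = of_int r * real L" using L by (simp add: field_simps)
    then have "of_int (int n - int m) = (of_int (r * int L) :: real)" by simp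
    then have "int n - int m = r * int L" by (simp only: of_int_eq_iff)
    then have "int L dvd int n - int m" by simp
    moreover have "\<bar>int n - int m\<bar> < int L" using assms by auto
    ultimately have "int n - int m = 0" using zdvd_not_zless[of "\<bar>int n - int m\<bar>" "int L"] by auto
    then show False using that by simp
  qed
  show ?thesis
    unfolding summand using geometric_sum[of q L] q1 qL by (cases "n = m") (auto simp: q_def)
qed

text \<open>Roots of unity of order \<open>L\<close> integrate trigonometric polynomials of degree below \<open>L\<close> exactly, so this is
  Parseval's identity on the circle with a finite average in place of the integral.\<close>

lemma roots_of_unity_parseval:
  fixes u :: "nat \<Rightarrow> 'h::complex_inner"
  assumes "J \<le> L"
  shows "(\<Sum>l<L. (norm (\<Sum>n<J. cis (2 * pi * real l / real L) ^ n *\<^sub>C u n))\<^sup>2)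
    = real L * (\<Sum>n<J. (norm (u n))\<^sup>2)"
proof -
  let ?z = "\<lambda>l. cis (2 * pi * real l / real L)"
  have "complex_of_real (\<Sum>l<L. (norm (\<Sum>n<J. ?z l ^ n *\<^sub>C u n))\<^sup>2)
      = (\<Sum>l<L. \<Sum>n<J. \<Sum>m<J. ?z l ^ n * cnj (?z l ^ m) * cinner (u n) (u m))"
    by (simp only: of_real_sum norm_sum_scaleC)
  also have "\<dots> = (\<Sum>n<J. \<Sum>l<L. \<Sum>m<J. ?z l ^ n * cnj (?z l ^ m) * cinner (u n) (u m))"
    by (rule sum.swap)
  also have "\<dots> = (\<Sum>n<J. \<Sum>m<J. \<Sum>l<L. ?z l ^ n * cnj (?z l ^ m) * cinner (u n) (u m))"
    by (rule sum.cong[OF refl], rule sum.swap)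
  also have "\<dots> = (\<Sum>n<J. \<Sum>m<J. if n = m then of_nat L * cinner (u n) (u m) else 0)"
    unfolding sum_distrib_right[symmetric]
    by (intro sum.cong refl, subst roots_of_unity_orthogonal) (use assms in auto)
  also have "\<dots> = of_real (real L * (\<Sum>n<J. (norm (u n))\<^sup>2))"
    by (simp add: cinner_self sum_distrib_left)
  finally show ?thesis by (simp only: of_real_eq_iff)
qed

lemma roots_of_unity_parseval_family:
  fixes u :: "nat \<Rightarrow> nat \<Rightarrow> 'h::complex_inner"
  assumes "J \<le> L"
  shows "(\<Sum>l<L. sum_norm_sq k (\<lambda>i. \<Sum>n<J. cis (2 * pi * real l / real L) ^ n *\<^sub>C u n i))
    = real L * (\<Sum>n<J. sum_norm_sq k (u n))"
  unfolding sum_norm_sq_def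
  by (subst sum.swap, subst (2) sum.swap) (simp only: roots_of_unity_parseval[OF assms] sum_distrib_left)

lemma bounded_clinear_funpow:
  fixes F :: "'k::complex_normed_vector \<Rightarrow> 'k"
  assumes "bounded_clinear F" shows "bounded_clinear (F ^^ n)"
proof (induction n)
  case 0 then show ?case by (simp add: bounded_clinear_id funpow.simps)
next
  case (Suc n)
  then show ?case using assms bounded_linear_compose[of F "F ^^ n"]
    by (simp add: bounded_clinear_def comp_def funpow.simps)
qed

text \<open>The vectors \<open>S z m = \<Sum>\<^bsub>n<m\<^esub> z\<^sup>n F\<^sup>n x\<close> are, up to factors of modulus one, the coordinates of
  \<open>\<Sum>\<^bsub>n<N\<^esub> z\<^sup>n W\<^sup>n x\<close>, where \<open>W\<close> is the isometric dilation \<open>(x\<^sub>0, x\<^sub>1, \<dots>) \<mapsto> (F x\<^sub>0, x\<^sub>0, x\<^sub>1, \<dots>)\<close> of \<open>F\<close>. Applying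
  \<open>z A + B\<close> to such a vector gives a sum whose inner terms are \<open>z\<^bsup>n+1\<^esup> F\<^sup>n y\<close> with \<open>y = (A + B F) x\<close>; the two
  boundary terms may be dropped. Averaging over \<open>z\<close> the norm bound for one of these vectors and the defect bounds
  for the shorter ones, then adding, the powers of \<open>F\<close> telescope and
  \<open>N \<parallel>y\<parallel>\<^sup>2 \<le> M (N + 1) \<parallel>x\<parallel>\<^sup>2\<close> remains for every \<open>N\<close>.\<close>

lemma dilation_inequality:
  fixes F :: "'k::complex_hilbert_space \<Rightarrow> 'k" and A B :: "nat \<Rightarrow> nat \<Rightarrow> 'k \<Rightarrow> 'k"
  assumes F: "bounded_clinear F" "\<And>x. norm (F x) \<le> norm x"
    and A: "\<And>i j. bounded_clinear (A i j)" "\<And>i j x. F (A i j x) = A i j (F x)"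
    and B: "\<And>i j. bounded_clinear (B i j)" "\<And>i j x. F (B i j x) = B i j (F x)"
    and bound: "\<And>z x. cmod z = 1 \<Longrightarrow> sum_norm_sq k (matrix_app k (\<lambda>i j v. z *\<^sub>C A i j v + B i j v) x) \<le> M * sum_norm_sq k x"
    and defect: "\<And>z x. cmod z = 1 \<Longrightarrow>
        sum_norm_sq k (matrix_app k (\<lambda>i j v. z *\<^sub>C A i j v + B i j v) x)
          - sum_norm_sq k (\<lambda>i. F (matrix_app k (\<lambda>i j v. z *\<^sub>C A i j v + B i j v) x i))
        \<le> M * (sum_norm_sq k x - sum_norm_sq k (\<lambda>i. F (x i)))"
  shows "sum_norm_sq k (matrix_app k (\<lambda>i j v. A i j v + B i j (F v)) x) \<le> M * sum_norm_sq k x"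
proof -
  define a b y where "a = matrix_app k A x" and "b = matrix_app k B x"
    and "y = matrix_app k (\<lambda>i j v. A i j v + B i j (F v)) x"
  have y: "y i = a i + F (b i)" for i
    by (simp add: y_def a_def b_def matrix_app_def sum.distrib bounded_clinearD[OF F(1)] B(2))
  note Fn = bounded_clinear_funpow[OF F(1)]
  have An: "(F ^^ n) (A i j v) = A i j ((F ^^ n) v)" for n i j v
    by (induction n) (simp_all add: A(2))
  have Bn: "(F ^^ n) (B i j v) = B i j ((F ^^ n) v)" for n i j v
    by (induction n) (simp_all add: B(2))
  define S where "S z m i = (\<Sum>n<m. z ^ n *\<^sub>C (F ^^ n) (x i))" for z m i
  \<comment> \<open>The coefficient of \<open>z ^ n\<close> in the image of \<open>S z m\<close>; those with \<open>0 < n < m\<close> are powers of \<open>F\<close> applied to \<open>y\<close>.\<close>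
  define w where "w m n i = (if n < m then (F ^^ n) (b i) else 0) + (if n = 0 then 0 else (F ^^ (n - 1)) (a i))"
    for m n i
  define C where "C z = matrix_app k (\<lambda>i j v. z *\<^sub>C A i j v + B i j v)" for z
  have CS: "C z (S z m) i = (\<Sum>n<Suc m. z ^ n *\<^sub>C w m n i)" for z m i
  proof -
    have "C z (S z m) i = (\<Sum>j<k. \<Sum>n<m. z ^ Suc n *\<^sub>C A i j ((F ^^ n) (x j)) + z ^ n *\<^sub>C B i j ((F ^^ n) (x j)))"
      unfolding C_def matrix_app_def S_def
      by (simp add: bounded_clinearD[OF A(1)] bounded_clinearD[OF B(1)] complex_vector.scale_sum_right
          sum.distrib scaleC_scaleC)
    also have "\<dots> = (\<Sum>n<m. \<Sum>j<k. z ^ Suc n *\<^sub>C A i j ((F ^^ n) (x j)) + z ^ n *\<^sub>C B i j ((F ^^ n) (x j)))"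
      by (rule sum.swap)
    also have "\<dots> = (\<Sum>n<m. z ^ Suc n *\<^sub>C (F ^^ n) (a i) + z ^ n *\<^sub>C (F ^^ n) (b i))"
      unfolding a_def b_def matrix_app_def bounded_clinear_sum[OF Fn] An Bn
      by (simp add: sum.distrib complex_vector.scale_sum_right)
    also have "\<dots> = (\<Sum>n<m. z ^ Suc n *\<^sub>C (F ^^ n) (a i)) + (\<Sum>n<m. z ^ n *\<^sub>C (F ^^ n) (b i))"
      by (rule sum.distrib)
    also have "(\<Sum>n<m. z ^ Suc n *\<^sub>C (F ^^ n) (a i))
        = (\<Sum>n<Suc m. z ^ n *\<^sub>C (if n = 0 then 0 else (F ^^ (n - 1)) (a i)))"
      unfolding sum.lessThan_Suc_shift by (simp add: complex_vector.scale_zero_right)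
    also have "(\<Sum>n<m. z ^ n *\<^sub>C (F ^^ n) (b i))
        = (\<Sum>n<Suc m. z ^ n *\<^sub>C (if n < m then (F ^^ n) (b i) else 0))"
      by (simp add: complex_vector.scale_zero_right)
    finally show ?thesis by (simp add: w_def scaleC_add_right sum.distrib add.commute)
  qed
  have FC: "F (\<Sum>n<m. z ^ n *\<^sub>C u n) = (\<Sum>n<m. z ^ n *\<^sub>C F (u n))" for z m u
    by (simp add: bounded_clinearD[OF F(1)])
  have "w (Suc m) (Suc n) i = (F ^^ n) (y i)" if "n < m" for m n i
    using that by (simp add: w_def y bounded_clinear_add[OF Fn] funpow_swap1 add.commute)
  then have w_mid: "w (Suc m) (Suc n) = (\<lambda>i. (F ^^ n) (y i))" if "n < m" for m n
    using that by blast
  define X Y where "X n = sum_norm_sq k (\<lambda>i. (F ^^ n) (x i))" and "Y n = sum_norm_sq k (\<lambda>i. (F ^^ n) (y i))" for n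
  have F0: "sum_norm_sq k (\<lambda>i. F (v i)) \<le> sum_norm_sq k v" for v
    unfolding sum_norm_sq_def by (intro sum_mono power_mono F(2)) simp
  \<comment> \<open>The norm bound at \<open>S z (m + 1)\<close>, averaged.\<close>
  have H1: "(\<Sum>n<m. Y n) \<le> M * (\<Sum>n<Suc m. X n)" for m
  proof -
    define L where "L = Suc (Suc m)"
    let ?z = "\<lambda>l. cis (2 * pi * real l / real L)"
    have "(\<Sum>l<L. sum_norm_sq k (C (?z l) (S (?z l) (Suc m)))) \<le> (\<Sum>l<L. M * sum_norm_sq k (S (?z l) (Suc m)))"
      unfolding C_def by (intro sum_mono bound) simp
    also have "(\<Sum>l<L. M * sum_norm_sq k (S (?z l) (Suc m))) = M * (real L * (\<Sum>n<Suc m. X n))"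
      unfolding S_def sum_distrib_left[symmetric] X_def
      by (subst roots_of_unity_parseval_family) (simp_all add: L_def)
    also have "(\<Sum>l<L. sum_norm_sq k (C (?z l) (S (?z l) (Suc m)))) = real L * (\<Sum>n<Suc (Suc m). sum_norm_sq k (w (Suc m) n))"
      unfolding CS by (subst roots_of_unity_parseval_family) (simp_all add: L_def)
    finally have "(\<Sum>n<Suc (Suc m). sum_norm_sq k (w (Suc m) n)) \<le> M * (\<Sum>n<Suc m. X n)"
      by (simp add: L_def mult.left_commute[of M])
    moreover have "(\<Sum>n<Suc (Suc m). sum_norm_sq k (w (Suc m) n))
        = sum_norm_sq k (w (Suc m) 0) + (\<Sum>n<m. sum_norm_sq k (w (Suc m) (Suc n))) + sum_norm_sq k (w (Suc m) (Suc m))"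
      by (subst sum.lessThan_Suc, subst sum.lessThan_Suc_shift) simp
    moreover have "(\<Sum>n<m. sum_norm_sq k (w (Suc m) (Suc n))) = (\<Sum>n<m. Y n)"
      by (rule sum.cong) (simp_all add: w_mid Y_def)
    ultimately show ?thesis
      using sum_norm_sq_nonneg[of k "w (Suc m) 0"] sum_norm_sq_nonneg[of k "w (Suc m) (Suc m)"] by linarith
  qed
  \<comment> \<open>The defect bound at \<open>S z (m + 1)\<close>, averaged; both sides telescope.\<close>
  have H2: "Y 0 - Y m \<le> M * (X 0 - X (Suc m))" for m
  proof -
    define L where "L = Suc (Suc m)"
    let ?z = "\<lambda>l. cis (2 * pi * real l / real L)"
    have "(\<Sum>l<L. sum_norm_sq k (C (?z l) (S (?z l) (Suc m))) - sum_norm_sq k (\<lambda>i. F (C (?z l) (S (?z l) (Suc m)) i)))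
       \<le> (\<Sum>l<L. M * (sum_norm_sq k (S (?z l) (Suc m)) - sum_norm_sq k (\<lambda>i. F (S (?z l) (Suc m) i))))"
      unfolding C_def by (intro sum_mono defect) simp
    also have "\<dots> = M * (real L * (\<Sum>n<Suc m. X n) - real L * (\<Sum>n<Suc m. X (Suc n)))"
      unfolding S_def FC sum_distrib_left[symmetric] sum_subtractf X_def
      by (subst (1 2) roots_of_unity_parseval_family) (simp_all add: L_def)
    also have "\<dots> = real L * (M * (X 0 - X (Suc m)))"
    proof -
      have "(\<Sum>n<Suc m. X n) - (\<Sum>n<Suc m. X (Suc n)) = X 0 - X (Suc m)"
        by (simp only: sum_subtractf[symmetric] sum_lessThan_telescope')
      then have "real L * (\<Sum>n<Suc m. X n) - real L * (\<Sum>n<Suc m. X (Suc n)) = real L * (X 0 - X (Suc m))"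
        by (simp only: right_diff_distrib[symmetric])
      then show ?thesis by (simp only: mult.left_commute)
    qed
    also have "(\<Sum>l<L. sum_norm_sq k (C (?z l) (S (?z l) (Suc m))) - sum_norm_sq k (\<lambda>i. F (C (?z l) (S (?z l) (Suc m)) i)))
        = real L * (\<Sum>n<Suc (Suc m). sum_norm_sq k (w (Suc m) n) - sum_norm_sq k (\<lambda>i. F (w (Suc m) n i)))"
      unfolding CS FC sum_subtractf right_diff_distrib
      by (subst (1 2) roots_of_unity_parseval_family) (simp_all add: L_def)
    finally have le: "(\<Sum>n<Suc (Suc m). sum_norm_sq k (w (Suc m) n) - sum_norm_sq k (\<lambda>i. F (w (Suc m) n i))) \<le> M * (X 0 - X (Suc m))"
      by (simp only: L_def mult_le_cancel_left_pos of_nat_0_less_iff zero_less_Suc)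
    define D where "D n = sum_norm_sq k (w (Suc m) n) - sum_norm_sq k (\<lambda>i. F (w (Suc m) n i))" for n
    have "(\<Sum>n<Suc (Suc m). D n) = D 0 + (\<Sum>n<m. D (Suc n)) + D (Suc m)"
      by (subst sum.lessThan_Suc, subst sum.lessThan_Suc_shift) simp
    moreover have "(\<Sum>n<m. D (Suc n)) = (\<Sum>n<m. Y n - Y (Suc n))"
      by (rule sum.cong) (simp_all add: w_mid Y_def D_def)
    moreover have "(\<Sum>n<m. Y n - Y (Suc n)) = Y 0 - Y m" by (rule sum_lessThan_telescope')
    moreover have "D n \<ge> 0" for n using F0[of "w (Suc m) n"] by (simp add: D_def)
    ultimately show ?thesis using le by (fold D_def) (smt (verit))
  qed
  have N: "real N * Y 0 \<le> real N * (M * X 0) + M * X 0" for N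
  proof -
    have "(\<Sum>m<N. Y 0 - Y m) \<le> (\<Sum>m<N. M * (X 0 - X (Suc m)))" by (intro sum_mono H2)
    then have "real N * Y 0 - (\<Sum>m<N. Y m) \<le> M * (real N * X 0 - (\<Sum>m<N. X (Suc m)))"
      by (simp add: sum_subtractf sum_distrib_left[symmetric])
    moreover have "(\<Sum>m<N. Y m) \<le> M * (X 0 + (\<Sum>m<N. X (Suc m)))"
      using H1[of N] by (simp only: sum.lessThan_Suc_shift)
    ultimately show ?thesis by (simp add: algebra_simps)
  qed
  have "Y 0 \<le> M * X 0"
  proof (rule ccontr)
    assume "\<not> Y 0 \<le> M * X 0"
    then have "Y 0 - M * X 0 > 0" by simp
    then obtain N :: nat where "M * X 0 < real N * (Y 0 - M * X 0)" using reals_Archimedean3 by blast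
    then show False using N[of N] by (simp add: algebra_simps)
  qed
  then show ?thesis by (simp add: X_def Y_def y_def)
qed

section \<open>The upper bound\<close>

text \<open>For \<open>x = \<Sum>\<^sub>p e\<^sub>p \<otimes> c\<^sub>p\<close>, the difference of the two sides is the sum of the entries of the Schur product of the
  Gram matrix of the vectors \<open>e\<^sub>p\<close> for the form \<open>M \<parallel>e\<parallel>\<^sup>2 - \<parallel>C e\<parallel>\<^sup>2\<close> with the Gram matrix of the vectors \<open>c\<^sub>p\<close> for
  the form \<open>\<parallel>c\<parallel>\<^sup>2 - \<parallel>T c\<parallel>\<^sup>2\<close>. The index \<open>p\<close> runs over the pairs of a coordinate \<open>j < k\<close> and a position in the list
  \<open>ds j\<close>.\<close>

lemma slot3_defect_tensor_sums:
  fixes t :: "'a::complex_hilbert_space \<Rightarrow> 'b::complex_hilbert_space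
      \<Rightarrow> 'c::complex_hilbert_space \<Rightarrow> 'k::complex_hilbert_space"
    and h :: 'c
  assumes t: "hilbert_tensor3 t" and h: "norm h = 1"
    and T: "bounded_clinear T" "\<And>c. norm (T c) \<le> norm c"
    and F: "bounded_clinear F" "\<And>a b c. F (t a b c) = t a b (T c)"
    and C: "\<And>i j. slot3_free t (C i j)"
    and bound: "\<And>x. sum_norm_sq k (matrix_app k C x) \<le> M * sum_norm_sq k x"
    and x: "x = (\<lambda>j. tensor_sum t (ds j))"
  shows "sum_norm_sq k (matrix_app k C x) - sum_norm_sq k (\<lambda>i. F (matrix_app k C x i)) \<le> M * (sum_norm_sq k x - sum_norm_sq k (\<lambda>i. F (x i)))"
proof -
  define I where "I = Sigma {..<k} (\<lambda>j. {..<length (ds j)})"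
  have fin: "finite I" by (simp add: I_def)
  define a b c where "a p = fst (ds (fst p) ! snd p)" and "b p = fst (snd (ds (fst p) ! snd p))"
    and "c p = snd (snd (ds (fst p) ! snd p))" for p
  define Y where "Y \<gamma> p j = (if fst p = j then t (a p) (b p) (\<gamma> p) else 0)" for \<gamma> p and j :: nat
  define Z where "Z \<gamma> p i = C i (fst p) (t (a p) (b p) (\<gamma> p))" for \<gamma> p i
  define H where "H = (\<lambda>p :: nat \<times> nat. h)"
  note Cb = slot3_free_bounded[OF C]
  have CY: "matrix_app k C (\<lambda>j. \<Sum>p\<in>I. \<xi> p *\<^sub>C Y \<gamma> p j) i = (\<Sum>p\<in>I. \<xi> p *\<^sub>C Z \<gamma> p i)" for \<xi> \<gamma> i
  proof -
    have "matrix_app k C (\<lambda>j. \<Sum>p\<in>I. \<xi> p *\<^sub>C Y \<gamma> p j) i = (\<Sum>j<k. \<Sum>p\<in>I. \<xi> p *\<^sub>C C i j (Y \<gamma> p j))"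
      by (simp add: matrix_app_def bounded_clinearD[OF Cb])
    also have "\<dots> = (\<Sum>p\<in>I. \<Sum>j<k. \<xi> p *\<^sub>C C i j (Y \<gamma> p j))" by (rule sum.swap)
    also have "\<dots> = (\<Sum>p\<in>I. \<xi> p *\<^sub>C Z \<gamma> p i)"
    proof (rule sum.cong[OF refl])
      fix p assume "p \<in> I"
      then have p: "fst p < k" by (auto simp: I_def)
      have "(\<Sum>j<k. \<xi> p *\<^sub>C C i j (Y \<gamma> p j)) = (\<Sum>j<k. if fst p = j then \<xi> p *\<^sub>C Z \<gamma> p i else 0)"
        by (rule sum.cong)
          (auto simp: Y_def Z_def bounded_clinear_zero[OF Cb] complex_vector.scale_zero_right)
      then show "(\<Sum>j<k. \<xi> p *\<^sub>C C i j (Y \<gamma> p j)) = \<xi> p *\<^sub>C Z \<gamma> p i" using p by simp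
    qed
    finally show ?thesis .
  qed
  have Yx: "(\<Sum>p\<in>I. Y \<gamma> p j) = (\<Sum>l<length (ds j). t (a (j, l)) (b (j, l)) (\<gamma> (j, l)))" if "j < k" for \<gamma> j
  proof -
    have "(\<Sum>p\<in>I. Y \<gamma> p j) = (\<Sum>i<k. \<Sum>l<length (ds i). if i = j then t (a (j, l)) (b (j, l)) (\<gamma> (j, l)) else 0)"
      unfolding I_def by (subst sum.Sigma) (auto simp: Y_def intro!: sum.cong)
    also have "\<dots> = (\<Sum>i<k. if i = j then \<Sum>l<length (ds j). t (a (j, l)) (b (j, l)) (\<gamma> (j, l)) else 0)"
      by (rule sum.cong) auto
    finally show ?thesis using that by simp
  qed
  have Yc: "(\<Sum>p\<in>I. Y c p j) = x j" if "j < k" for j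
    unfolding Yx[OF that] x tensor_sum_nth by (simp add: a_def b_def c_def)
  have YT: "(\<Sum>p\<in>I. Y (\<lambda>p. T (c p)) p j) = F (x j)" if "j < k" for j
    unfolding Yx[OF that] x tensor_sum_nth bounded_clinear_sum[OF F(1)] F(2) by (simp add: a_def b_def c_def)
  have Z1: "(\<Sum>p\<in>I. Z \<gamma> p i) = matrix_app k C (\<lambda>j. \<Sum>p\<in>I. Y \<gamma> p j) i" for \<gamma> i
    using CY[of "\<lambda>_. 1" \<gamma> i] by (simp add: scaleC_one)
  have app_cong: "matrix_app k C v i = matrix_app k C v' i" if "\<And>j. j < k \<Longrightarrow> v j = v' j" for v v' i
    unfolding matrix_app_def by (rule sum.cong) (use that in auto)
  have Zc: "(\<Sum>p\<in>I. Z c p i) = matrix_app k C x i" for i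
    unfolding Z1 by (rule app_cong) (rule Yc)
  have ZT: "(\<Sum>p\<in>I. Z (\<lambda>p. T (c p)) p i) = F (matrix_app k C x i)" for i
  proof -
    have "(\<Sum>p\<in>I. Z (\<lambda>p. T (c p)) p i) = matrix_app k C (\<lambda>j. F (x j)) i"
      unfolding Z1 by (rule app_cong) (rule YT)
    also have "\<dots> = F (matrix_app k C x i)"
      unfolding matrix_app_def bounded_clinear_sum[OF F(1)] slot3_free_commute[OF t F C] ..
    finally show ?thesis .
  qed
  define Q where "Q p q = of_real M * (\<Sum>j<k. cinner (Y H p j) (Y H q j)) - (\<Sum>i<k. cinner (Z H p i) (Z H q i))" for p q
  have psdQ: "psd I Q"
    unfolding Q_def
  proof (rule psd_gram_diff)
    fix \<xi>
    show "(\<Sum>i<k. (norm (\<Sum>p\<in>I. \<xi> p *\<^sub>C Z H p i))\<^sup>2) \<le> M * (\<Sum>j<k. (norm (\<Sum>p\<in>I. \<xi> p *\<^sub>C Y H p j))\<^sup>2)"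
      using bound[of "\<lambda>j. \<Sum>p\<in>I. \<xi> p *\<^sub>C Y H p j"] unfolding sum_norm_sq_def CY .
  qed
  have Yin: "(\<Sum>j<k. cinner (Y H p j) (Y H q j)) * cinner (\<gamma> p) (\<gamma> q) = (\<Sum>j<k. cinner (Y \<gamma> p j) (Y \<gamma> q j))" for \<gamma> p q
    unfolding sum_distrib_right
    by (rule sum.cong[OF refl]) (auto simp: Y_def H_def tensor_inner_unit[OF t h, of _ _ "\<gamma> p" _ _ "\<gamma> q"])
  have Zin: "(\<Sum>i<k. cinner (Z H p i) (Z H q i)) * cinner (\<gamma> p) (\<gamma> q) = (\<Sum>i<k. cinner (Z \<gamma> p i) (Z \<gamma> q i))" for \<gamma> p q
    unfolding sum_distrib_right
    by (rule sum.cong[OF refl])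
      (simp add: Z_def H_def slot3_free_inner[OF t h C C, of _ _ _ _ "\<gamma> p" _ _ _ _ "\<gamma> q"])
  have E: "(\<Sum>p\<in>I. \<Sum>q\<in>I. Q p q * cinner (\<gamma> p) (\<gamma> q)) =
      of_real (M * (\<Sum>j<k. (norm (\<Sum>p\<in>I. Y \<gamma> p j))\<^sup>2) - (\<Sum>i<k. (norm (\<Sum>p\<in>I. Z \<gamma> p i))\<^sup>2))" for \<gamma>
    unfolding Q_def left_diff_distrib mult.assoc Yin Zin of_real_diff of_real_mult norm_sum_gram_family
    by (simp only: sum_subtractf sum_distrib_left)
  have "0 \<le> Re (\<Sum>p\<in>I. \<Sum>q\<in>I. Q p q * (cinner (c p) (c q) - cinner (T (c p)) (T (c q))))"
    by (rule schur_product_nonneg[OF fin psd_contraction_defect[OF T] psdQ])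
  also have "(\<Sum>p\<in>I. \<Sum>q\<in>I. Q p q * (cinner (c p) (c q) - cinner (T (c p)) (T (c q)))) =
     (\<Sum>p\<in>I. \<Sum>q\<in>I. Q p q * cinner (c p) (c q)) - (\<Sum>p\<in>I. \<Sum>q\<in>I. Q p q * cinner (T (c p)) (T (c q)))"
    by (simp only: right_diff_distrib sum_subtractf)
  also have "\<dots> = of_real ((M * (\<Sum>j<k. (norm (\<Sum>p\<in>I. Y c p j))\<^sup>2) - (\<Sum>i<k. (norm (\<Sum>p\<in>I. Z c p i))\<^sup>2))
      - (M * (\<Sum>j<k. (norm (\<Sum>p\<in>I. Y (\<lambda>p. T (c p)) p j))\<^sup>2) - (\<Sum>i<k. (norm (\<Sum>p\<in>I. Z (\<lambda>p. T (c p)) p i))\<^sup>2)))"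
    unfolding E[of c] E[of "\<lambda>p. T (c p)"] of_real_diff ..
  finally have "0 \<le> (M * (\<Sum>j<k. (norm (\<Sum>p\<in>I. Y c p j))\<^sup>2) - (\<Sum>i<k. (norm (\<Sum>p\<in>I. Z c p i))\<^sup>2))
      - (M * (\<Sum>j<k. (norm (\<Sum>p\<in>I. Y (\<lambda>p. T (c p)) p j))\<^sup>2) - (\<Sum>i<k. (norm (\<Sum>p\<in>I. Z (\<lambda>p. T (c p)) p i))\<^sup>2))"
    by (simp only: Re_complex_of_real)
  also have "(\<Sum>j<k. (norm (\<Sum>p\<in>I. Y c p j))\<^sup>2) = sum_norm_sq k x"
    unfolding sum_norm_sq_def by (rule sum.cong) (simp_all add: Yc)
  also have "(\<Sum>j<k. (norm (\<Sum>p\<in>I. Y (\<lambda>p. T (c p)) p j))\<^sup>2) = sum_norm_sq k (\<lambda>j. F (x j))"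
    unfolding sum_norm_sq_def by (rule sum.cong) (simp_all add: YT)
  finally show ?thesis unfolding Zc ZT by (simp add: sum_norm_sq_def algebra_simps)
qed

lemma slot3_defect:
  fixes t :: "'a::complex_hilbert_space \<Rightarrow> 'b::complex_hilbert_space
      \<Rightarrow> 'c::complex_hilbert_space \<Rightarrow> 'k::complex_hilbert_space"
    and h :: 'c
  assumes t: "hilbert_tensor3 t" and h: "norm h = 1"
    and T: "bounded_clinear T" "\<And>c. norm (T c) \<le> norm c"
    and F: "bounded_clinear F" "\<And>a b c. F (t a b c) = t a b (T c)"
    and C: "\<And>i j. slot3_free t (C i j)"
    and bound: "\<And>x. sum_norm_sq k (matrix_app k C x) \<le> M * sum_norm_sq k x"
  shows "sum_norm_sq k (matrix_app k C x) - sum_norm_sq k (\<lambda>i. F (matrix_app k C x i)) \<le> M * (sum_norm_sq k x - sum_norm_sq k (\<lambda>i. F (x i)))"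
proof -
  have "\<exists>d. (\<lambda>n. tensor_sum t (d n)) \<longlonglongrightarrow> x j" for j
  proof -
    have "x j \<in> closure (range (tensor_sum t))" using closure_tensor_sums[OF t] by simp
    then obtain s where s: "\<And>n. s n \<in> range (tensor_sum t)" "s \<longlonglongrightarrow> x j" unfolding closure_sequential by blast
    then have "\<forall>n. \<exists>d. s n = tensor_sum t d" by blast
    then obtain d where "\<forall>n. s n = tensor_sum t (d n)" by metis
    then have "s = (\<lambda>n. tensor_sum t (d n))" by auto
    then show ?thesis using s(2) by blast
  qed
  then obtain d where d: "\<And>j. (\<lambda>n. tensor_sum t (d j n)) \<longlonglongrightarrow> x j" by metis
  define X where "X n = (\<lambda>j. tensor_sum t (d j n))" for n
  have X: "(\<lambda>n. X n j) \<longlonglongrightarrow> x j" for j unfolding X_def by (rule d)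
  note Cb = slot3_free_bounded[OF C]
  have ap: "(\<lambda>n. matrix_app k C (X n) i) \<longlonglongrightarrow> matrix_app k C x i" for i
    unfolding matrix_app_def by (intro tendsto_sum bounded_linear.tendsto[OF bounded_clinear_bounded_linear[OF Cb]] X)
  have FX: "(\<lambda>n. F (u n)) \<longlonglongrightarrow> F y" if "u \<longlonglongrightarrow> y" for u y
    using bounded_linear.tendsto[OF bounded_clinear_bounded_linear[OF F(1)] that] .
  have sq: "(\<lambda>n. sum_norm_sq k (u n)) \<longlonglongrightarrow> sum_norm_sq k y" if "\<And>j. (\<lambda>n. u n j) \<longlonglongrightarrow> y j" for u and y :: "nat \<Rightarrow> 'k"
    unfolding sum_norm_sq_def by (intro tendsto_sum tendsto_power tendsto_norm that)
  have 1: "(\<lambda>n. sum_norm_sq k (matrix_app k C (X n)) - sum_norm_sq k (\<lambda>i. F (matrix_app k C (X n) i)))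
      \<longlonglongrightarrow> sum_norm_sq k (matrix_app k C x) - sum_norm_sq k (\<lambda>i. F (matrix_app k C x i))"
    by (intro tendsto_diff sq FX ap)
  have 2: "(\<lambda>n. M * (sum_norm_sq k (X n) - sum_norm_sq k (\<lambda>i. F (X n i)))) \<longlonglongrightarrow> M * (sum_norm_sq k x - sum_norm_sq k (\<lambda>i. F (x i)))"
    by (intro tendsto_mult tendsto_const tendsto_diff sq FX X)
  have "sum_norm_sq k (matrix_app k C (X n)) - sum_norm_sq k (\<lambda>i. F (matrix_app k C (X n) i)) \<le> M * (sum_norm_sq k (X n) - sum_norm_sq k (\<lambda>i. F (X n i)))" for n
    by (rule slot3_defect_tensor_sums[OF t h T F C bound X_def])
  then show ?thesis by (intro LIMSEQ_le[OF 1 2]) blast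
qed

lemma slot3_dilation:
  fixes t :: "'a::complex_hilbert_space \<Rightarrow> 'b::complex_hilbert_space
      \<Rightarrow> 'c::complex_hilbert_space \<Rightarrow> 'k::complex_hilbert_space"
    and h :: 'c
  assumes t: "hilbert_tensor3 t" and h: "norm h = 1"
    and T: "bounded_clinear T" "\<And>c. norm (T c) \<le> norm c"
    and F: "bounded_clinear F" "\<And>a b c. F (t a b c) = t a b (T c)" "\<And>x. norm (F x) \<le> norm x"
    and A: "\<And>i j. slot3_free t (A i j)" and B: "\<And>i j. slot3_free t (B i j)"
    and bound: "\<And>z x. cmod z = 1 \<Longrightarrow> sum_norm_sq k (matrix_app k (\<lambda>i j v. A i j v + z *\<^sub>C B i j v) x) \<le> M * sum_norm_sq k x"
  shows "sum_norm_sq k (matrix_app k (\<lambda>i j v. A i j v + B i j (F v)) x) \<le> M * sum_norm_sq k x"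
proof -
  have bound': "sum_norm_sq k (matrix_app k (\<lambda>i j v. z *\<^sub>C A i j v + B i j v) x) \<le> M * sum_norm_sq k x" if z: "cmod z = 1" for z x
  proof -
    \<comment> \<open>Moving the unimodular factor from \<open>B\<close> to \<open>A\<close> multiplies the operator by a unimodular scalar.\<close>
    have zz: "z * cnj z = 1" using complex_norm_square[of z] z by simp
    have "matrix_app k (\<lambda>i j v. z *\<^sub>C A i j v + B i j v) x i = z *\<^sub>C matrix_app k (\<lambda>i j v. A i j v + cnj z *\<^sub>C B i j v) x i" for i
      by (simp add: matrix_app_def complex_vector.scale_sum_right scaleC_add_right scaleC_scaleC zz scaleC_one)
    then have "sum_norm_sq k (matrix_app k (\<lambda>i j v. z *\<^sub>C A i j v + B i j v) x) = sum_norm_sq k (matrix_app k (\<lambda>i j v. A i j v + cnj z *\<^sub>C B i j v) x)"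
      by (simp add: sum_norm_sq_def norm_scaleC z)
    then show ?thesis using bound[of "cnj z" x] z by simp
  qed
  show ?thesis
  proof (rule dilation_inequality[OF F(1,3)])
    show "bounded_clinear (A i j)" "bounded_clinear (B i j)" for i j
      using A B by (blast intro: slot3_free_bounded)+
    show "F (A i j x) = A i j (F x)" "F (B i j x) = B i j (F x)" for i j x
      by (rule slot3_free_commute[OF t F(1,2)]; rule A B)+
    fix z :: complex and x assume z: "cmod z = 1"
    show "sum_norm_sq k (matrix_app k (\<lambda>i j v. z *\<^sub>C A i j v + B i j v) x) \<le> M * sum_norm_sq k x"
      by (rule bound'[OF z])
    show "sum_norm_sq k (matrix_app k (\<lambda>i j v. z *\<^sub>C A i j v + B i j v) x)
        - sum_norm_sq k (\<lambda>i. F (matrix_app k (\<lambda>i j v. z *\<^sub>C A i j v + B i j v) x i)) \<le> M * (sum_norm_sq k x - sum_norm_sq k (\<lambda>i. F (x i)))"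
      by (rule slot3_defect[OF t h T F(1,2) slot3_free_plus[OF slot3_free_scale[OF t A] B] bound'[OF z]])
  qed
qed

definition pencil :: "(nat \<Rightarrow> nat \<Rightarrow> complex) \<Rightarrow> (nat \<Rightarrow> nat \<Rightarrow> complex) \<Rightarrow> (nat \<Rightarrow> nat \<Rightarrow> complex)
    \<Rightarrow> ('k \<Rightarrow> 'k) \<Rightarrow> ('k \<Rightarrow> 'k) \<Rightarrow> ('k \<Rightarrow> 'k) \<Rightarrow> nat \<Rightarrow> nat \<Rightarrow> 'k \<Rightarrow> 'k::complex_vector" where
  "pencil V1 V2 V3 G1 G2 G3 i j v = V1 i j *\<^sub>C G1 v + V2 i j *\<^sub>C G2 v + V3 i j *\<^sub>C G3 v"

text \<open>Together with the rotation of the tensor factors, this reduces a replacement in any of the three slots to a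
  replacement in the third.\<close>

lemma pencil_rotate: "pencil V2 V3 V1 G2 G3 G1 = pencil V1 V2 V3 G1 G2 G3"
  by (intro ext) (simp add: pencil_def add_ac)

lemma slot3_pencil:
  fixes t :: "'a::complex_hilbert_space \<Rightarrow> 'b::complex_hilbert_space
      \<Rightarrow> 'c::complex_hilbert_space \<Rightarrow> 'k::complex_hilbert_space"
    and h :: 'c
  assumes t: "hilbert_tensor3 t" and h: "norm h = 1"
    and T: "bounded_clinear T" "\<And>c. norm (T c) \<le> norm c"
    and F: "bounded_clinear F" "\<And>a b c. F (t a b c) = t a b (T c)" "\<And>x. norm (F x) \<le> norm x"
    and G: "slot3_free t G1" "slot3_free t G2"
    and bound: "\<And>z x. cmod z = 1 \<Longrightarrow> sum_norm_sq k (matrix_app k (pencil V1 V2 V3 G1 G2 (\<lambda>v. z *\<^sub>C v)) x) \<le> M * sum_norm_sq k x"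
  shows "sum_norm_sq k (matrix_app k (pencil V1 V2 V3 G1 G2 F) x) \<le> M * sum_norm_sq k x"
proof -
  have "sum_norm_sq k (matrix_app k (\<lambda>i j v. (V1 i j *\<^sub>C G1 v + V2 i j *\<^sub>C G2 v) + V3 i j *\<^sub>C F v) x) \<le> M * sum_norm_sq k x"
  proof (rule slot3_dilation[OF t h T F])
    show "slot3_free t (\<lambda>v. V1 i j *\<^sub>C G1 v + V2 i j *\<^sub>C G2 v)" for i j
      by (intro slot3_free_plus slot3_free_scale t G)
    have id: "slot3_free t (\<lambda>v. v)"
      by (rule slot3_freeI[of _ _ "\<lambda>a. a" "\<lambda>b. b"]) (simp_all add: bounded_clinear_id)
    show "slot3_free t (\<lambda>v. V3 i j *\<^sub>C v)" for i j
      by (rule slot3_free_scale[OF t id])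
    fix z x assume "cmod z = 1"
    from bound[OF this, of x]
    show "sum_norm_sq k (matrix_app k (\<lambda>i j v. V1 i j *\<^sub>C G1 v + V2 i j *\<^sub>C G2 v + z *\<^sub>C V3 i j *\<^sub>C v) x) \<le> M * sum_norm_sq k x"
      by (simp add: pencil_def[abs_def] scaleC_scaleC mult.commute)
  qed
  then show ?thesis by (simp add: pencil_def[abs_def])
qed

lemma hilbert_tensor3_rotate:
  assumes "hilbert_tensor3 t" shows "hilbert_tensor3 (\<lambda>y z x. t x y z)"
proof -
  have "{t x y z | y z x. True} = {t x y z | x y z. True}" by blast
  then show ?thesis using assms unfolding hilbert_tensor3_def by (simp add: mult_ac)
qed

text \<open>The scalars are replaced by the operators in the order \<open>z3\<close>, \<open>z2\<close>, \<open>z1\<close>; after each step the remaining pencil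
  in the scalars still has the bound for all unimodular values.\<close>

lemma pencil_upper_bound:
  fixes t :: "'a::complex_hilbert_space \<Rightarrow> 'b::complex_hilbert_space
      \<Rightarrow> 'c::complex_hilbert_space \<Rightarrow> 'k::complex_hilbert_space"
    and h1 :: 'a and h2 :: 'b and h3 :: 'c
  assumes t: "hilbert_tensor3 t" and h: "norm h1 = 1" "norm h2 = 1" "norm h3 = 1"
    and T1: "bounded_clinear T1" "\<And>c. norm (T1 c) \<le> norm c"
    and T2: "bounded_clinear T2" "\<And>c. norm (T2 c) \<le> norm c"
    and T3: "bounded_clinear T3" "\<And>c. norm (T3 c) \<le> norm c"
    and F1: "bounded_clinear F1" "\<And>a b c. F1 (t a b c) = t (T1 a) b c" "\<And>x. norm (F1 x) \<le> norm x"
    and F2: "bounded_clinear F2" "\<And>a b c. F2 (t a b c) = t a (T2 b) c" "\<And>x. norm (F2 x) \<le> norm x"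
    and F3: "bounded_clinear F3" "\<And>a b c. F3 (t a b c) = t a b (T3 c)" "\<And>x. norm (F3 x) \<le> norm x"
    and bound: "\<And>z1 z2 z3 \<xi>. cmod z1 = 1 \<Longrightarrow> cmod z2 = 1 \<Longrightarrow> cmod z3 = 1 \<Longrightarrow>
       (\<Sum>i<k. (cmod (\<Sum>j<k. (V1 i j * z1 + V2 i j * z2 + V3 i j * z3) * \<xi> j))\<^sup>2) \<le> M * (\<Sum>j<k. (cmod (\<xi> j))\<^sup>2)"
  shows "sum_norm_sq k (matrix_app k (pencil V1 V2 V3 F1 F2 F3) x) \<le> M * sum_norm_sq k x"
proof -
  let ?s = "\<lambda>z v. z *\<^sub>C (v :: 'k)"
  have scalar_free: "slot3_free t' (?s z)" if "hilbert_tensor3 t'"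
    for z and t' :: "'x::complex_hilbert_space \<Rightarrow> 'y::complex_hilbert_space \<Rightarrow> 'w::complex_hilbert_space \<Rightarrow> 'k"
  proof -
    have "slot3_free t' (\<lambda>v. v)"
      by (rule slot3_freeI[of _ _ "\<lambda>a. a" "\<lambda>b. b"]) (simp_all add: bounded_clinear_id)
    then show ?thesis by (rule slot3_free_scale[OF that])
  qed
  have scalar: "sum_norm_sq k (matrix_app k (pencil V1 V2 V3 (?s z1) (?s z2) (?s z3)) x) \<le> M * sum_norm_sq k x"
    if "cmod z1 = 1" "cmod z2 = 1" "cmod z3 = 1" for z1 z2 z3 x
    using scalar_matrix_amplification[OF bound[OF that], of x]
    by (simp add: sum_norm_sq_def matrix_app_def pencil_def scaleC_scaleC scaleC_add_left)
  note t2 = hilbert_tensor3_rotate[OF hilbert_tensor3_rotate[OF t]]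
  note t1 = hilbert_tensor3_rotate[OF t]
  have step3: "sum_norm_sq k (matrix_app k (pencil V1 V2 V3 (?s z1) (?s z2) F3) x) \<le> M * sum_norm_sq k x"
    if "cmod z1 = 1" "cmod z2 = 1" for z1 z2 x
    by (rule slot3_pencil[OF t h(3) T3 F3 scalar_free[OF t] scalar_free[OF t] scalar]) (use that in simp_all)
  have step2: "sum_norm_sq k (matrix_app k (pencil V1 V2 V3 (?s z1) F2 F3) x) \<le> M * sum_norm_sq k x"
    if "cmod z1 = 1" for z1 x
  proof -
    have "sum_norm_sq k (matrix_app k (pencil V3 V1 V2 F3 (?s z1) F2) x) \<le> M * sum_norm_sq k x"
    proof (rule slot3_pencil[OF t2 h(2) T2 F2 _ scalar_free[OF t2]])
      show "slot3_free (\<lambda>y z x. t z x y) F3"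
        by (rule slot3_freeI[of _ _ T3 "\<lambda>b. b"]) (simp_all add: F3)
      show "sum_norm_sq k (matrix_app k (pencil V3 V1 V2 F3 (?s z1) (?s z)) x) \<le> M * sum_norm_sq k x" if "cmod z = 1" for z x
        using step3[OF \<open>cmod z1 = 1\<close> that] by (simp only: pencil_rotate[of V1 V2 V3, symmetric])
    qed
    then show ?thesis by (simp only: pencil_rotate[of V1 V2 V3, symmetric])
  qed
  have "sum_norm_sq k (matrix_app k (pencil V2 V3 V1 F2 F3 F1) x) \<le> M * sum_norm_sq k x"
  proof (rule slot3_pencil[OF t1 h(1) T1 F1])
    show "slot3_free (\<lambda>y z x. t x y z) F2"
      by (rule slot3_freeI[of _ _ T2 "\<lambda>b. b"]) (simp_all add: F2)
    show "slot3_free (\<lambda>y z x. t x y z) F3"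
      by (rule slot3_freeI[of _ _ "\<lambda>b. b" T3]) (simp_all add: F3)
    show "sum_norm_sq k (matrix_app k (pencil V2 V3 V1 F2 F3 (?s z)) x) \<le> M * sum_norm_sq k x" if "cmod z = 1" for z x
      using step2[OF that] by (simp only: pencil_rotate)
  qed
  then show ?thesis by (simp only: pencil_rotate)
qed

section \<open>The lower bound\<close>

lemma contractionD:
  assumes "contraction T" shows "bounded_clinear T" "norm (T x) \<le> norm x"
proof -
  show b: "bounded_clinear T" using assms by (simp add: contraction_def)
  have "norm (T x) \<le> onorm T * norm x" by (rule bounded_clinear_norm[OF b])
  also have "\<dots> \<le> 1 * norm x" using assms by (intro mult_right_mono) (auto simp: contraction_def)
  finally show "norm (T x) \<le> norm x" by simp
qed

text \<open>Solutions are fixed points of \<open>x \<mapsto> \<mu>\<^sup>-\<^sup>1 (T x - y)\<close>, whose Lipschitz constant is at most \<open>1 / \<bar>\<mu>\<bar>\<close>.\<close>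

lemma contraction_resolvent:
  fixes T :: "'a::complex_hilbert_space \<Rightarrow> 'a"
  assumes T: "contraction T" and \<mu>: "cmod \<mu> > 1"
  shows "\<exists>x. T x - \<mu> *\<^sub>C x = y"
proof -
  let ?g = "\<lambda>x. inverse \<mu> *\<^sub>C (T x - y)"
  have "\<exists>!x. ?g x = x"
  proof (rule banach_fix_type)
    show "0 \<le> inverse (cmod \<mu>)" "inverse (cmod \<mu>) < 1" using \<mu> by (simp_all add: inverse_less_1_iff)
    show "\<forall>x x'. dist (?g x) (?g x') \<le> inverse (cmod \<mu>) * dist x x'"
    proof (intro allI)
      fix x x'
      have "?g x - ?g x' = inverse \<mu> *\<^sub>C T (x - x')"
        by (simp add: bounded_clinear_diff[OF contractionD(1)[OF T]] complex_vector.scale_right_diff_distrib)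
      then show "dist (?g x) (?g x') \<le> inverse (cmod \<mu>) * dist x x'"
        using contractionD(2)[OF T, of "x - x'"] \<mu>
        by (simp add: dist_norm norm_scaleC norm_inverse mult_left_mono)
    qed
  qed
  then obtain x where "?g x = x" by blast
  then have "\<mu> *\<^sub>C x = \<mu> *\<^sub>C inverse \<mu> *\<^sub>C (T x - y)" by simp
  also have "\<dots> = T x - y"
  proof -
    have "\<mu> * inverse \<mu> = 1" by (rule right_inverse) (use \<mu> in auto)
    then show ?thesis by (simp only: scaleC_scaleC scaleC_one)
  qed
  finally show ?thesis by (intro exI[of _ x]) simp
qed

text \<open>Boundary points of the spectrum are approximate eigenvalues. If not, \<open>D = T - z\<close> is bounded below, so its range
  is closed. It is also dense: the solutions of \<open>T x - (1 + \<delta>) z x = y\<close> stay bounded as \<open>\<delta>\<close> tends to zero, hence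
  \<open>D x\<close> tends to \<open>y\<close>. Thus \<open>D\<close> has a bounded inverse, and \<open>z\<close> is not in the spectrum.\<close>

lemma approximate_eigenvector:
  fixes T :: "'a::complex_hilbert_space \<Rightarrow> 'a"
  assumes T: "contraction T" and z: "cmod z = 1" "z \<in> spectrum T" and \<epsilon>: "\<epsilon> > 0"
  shows "\<exists>u. norm u = 1 \<and> norm (T u - z *\<^sub>C u) < \<epsilon>"
proof (rule ccontr)
  assume no: "\<not> ?thesis"
  note Tb = contractionD(1)[OF T]
  define D where "D x = T x - z *\<^sub>C x" for x
  have Db: "bounded_clinear D"
    using bounded_clinear_plus[OF Tb bounded_clinear_scale[OF bounded_clinear_id(1), of "- z"]]
    by (simp add: D_def[abs_def])
  have below: "\<epsilon> * norm x \<le> norm (D x)" for x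
  proof (cases "x = 0")
    case False
    define u where "u = complex_of_real (1 / norm x) *\<^sub>C x"
    have "norm u = 1" using False by (simp add: u_def norm_scaleC norm_divide)
    then have "\<epsilon> \<le> norm (D u)" using no by (force simp: D_def)
    also have "D u = complex_of_real (1 / norm x) *\<^sub>C D x"
      unfolding u_def by (rule bounded_clinear_scaleC[OF Db])
    finally show ?thesis using False by (simp add: norm_scaleC norm_divide field_simps)
  qed simp
  have "complete (range D)"
    by (rule complete_isometric_image[OF \<epsilon> subspace_UNIV bounded_clinear_bounded_linear[OF Db]])
      (use below in \<open>auto simp: complete_UNIV\<close>)
  then have cl: "closed (range D)" by (rule complete_imp_closed)
  have "y \<in> closure (range D)" for y
    unfolding closure_approachable
  proof (intro allI impI)
    fix e :: real assume e: "e > 0"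
    define \<delta> where "\<delta> = min (\<epsilon> / 2) (e * \<epsilon> / (4 * (norm y + 1)))"
    have pos: "norm y + 1 > 0" by (rule add_nonneg_pos) simp_all
    have \<delta>: "\<delta> > 0" "\<delta> \<le> \<epsilon> / 2" "\<delta> \<le> e * \<epsilon> / (4 * (norm y + 1))"
      unfolding \<delta>_def using \<epsilon> e pos by (simp_all only: min.cobounded1 min.cobounded2) simp
    have "cmod (complex_of_real (1 + \<delta>) * z) = 1 + \<delta>"
      unfolding norm_mult z norm_of_real using \<delta>(1) by simp
    then have "cmod (complex_of_real (1 + \<delta>) * z) > 1" using \<delta>(1) by simp
    from contraction_resolvent[OF T this] obtain x where "T x - (complex_of_real (1 + \<delta>) * z) *\<^sub>C x = y" by blast
    then have Dx: "D x = y + (complex_of_real \<delta> * z) *\<^sub>C x"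
      by (auto simp: D_def distrib_right scaleC_add_left)
    have nx: "norm ((complex_of_real \<delta> * z) *\<^sub>C x) = \<delta> * norm x"
      using \<delta>(1) z(1) by (simp add: norm_scaleC norm_mult)
    have "\<epsilon> * norm x \<le> norm y + \<delta> * norm x"
      using below[of x] norm_triangle_ineq[of y "(complex_of_real \<delta> * z) *\<^sub>C x"] unfolding Dx nx by linarith
    also have "\<dots> \<le> norm y + \<epsilon> / 2 * norm x" by (intro add_left_mono mult_right_mono \<delta>) simp
    finally have "\<epsilon> * norm x \<le> 2 * norm y" by simp
    moreover have "\<delta> * norm x \<le> e * \<epsilon> / (4 * (norm y + 1)) * norm x" by (intro mult_right_mono \<delta>) simp
    moreover have "e * \<epsilon> / (4 * (norm y + 1)) * norm x = e / (4 * (norm y + 1)) * (\<epsilon> * norm x)" by simp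
    moreover have "e / (4 * (norm y + 1)) * (\<epsilon> * norm x) \<le> e / (4 * (norm y + 1)) * (2 * norm y)"
      using \<open>\<epsilon> * norm x \<le> 2 * norm y\<close> by (rule mult_left_mono) (use e pos in simp)
    moreover have "e / (4 * (norm y + 1)) * (2 * norm y) < e"
    proof -
      have "e * (2 * norm y) < e * (4 * (norm y + 1))" using e pos by simp
      then show ?thesis using pos by (simp add: divide_less_eq)
    qed
    ultimately have "dist (D x) y < e" by (simp add: dist_norm Dx nx)
    then show "\<exists>w\<in>range D. dist w y < e" by blast
  qed
  then have surj: "surj D" using cl by auto
  have inj: "inj D"
  proof (rule injI)
    fix x y assume "D x = D y"
    then have "D (x - y) = 0" by (simp add: bounded_clinear_diff[OF Db])
    then have "\<epsilon> * norm (x - y) \<le> 0" using below[of "x - y"] by simp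
    then show "x = y" using \<epsilon> by (simp add: mult_le_0_iff)
  qed
  define S where "S = inv D"
  have DS: "D (S y) = y" for y unfolding S_def by (rule surj_f_inv_f[OF surj])
  have SD: "S (D x) = x" for x unfolding S_def by (rule inv_f_f[OF inj])
  have "bounded_clinear S"
  proof (rule bounded_clinearI)
    show "S (x + y) = S x + S y" for x y
      by (rule injD[OF inj]) (simp add: DS bounded_clinear_add[OF Db])
    show "S (c *\<^sub>C x) = c *\<^sub>C S x" for c x
      by (rule injD[OF inj]) (simp add: DS bounded_clinear_scaleC[OF Db])
    show "norm (S x) \<le> norm x * (1 / \<epsilon>)" for x
      using below[of "S x"] \<epsilon> by (simp add: DS field_simps)
  qed
  then have "z \<notin> spectrum T"
    unfolding spectrum_def using SD DS by (auto simp: D_def)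
  with z(2) show False by simp
qed

lemma joint_approximate_eigenvectors:
  fixes t :: "'a::complex_hilbert_space \<Rightarrow> 'b::complex_hilbert_space
      \<Rightarrow> 'c::complex_hilbert_space \<Rightarrow> 'k::complex_hilbert_space"
  assumes t: "hilbert_tensor3 t"
    and T: "contraction T1" "contraction T2" "contraction T3"
    and spec: "z1 \<in> spectrum T1" "z2 \<in> spectrum T2" "z3 \<in> spectrum T3"
    and z: "cmod z1 = 1" "cmod z2 = 1" "cmod z3 = 1"
    and F1: "\<And>a b c. F1 (t a b c) = t (T1 a) b c"
    and F2: "\<And>a b c. F2 (t a b c) = t a (T2 b) c"
    and F3: "\<And>a b c. F3 (t a b c) = t a b (T3 c)"
  shows "\<exists>u. (\<forall>n. norm (u n) = 1) \<and> (\<lambda>n. F1 (u n) - z1 *\<^sub>C u n) \<longlonglongrightarrow> 0 \<and>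
    (\<lambda>n. F2 (u n) - z2 *\<^sub>C u n) \<longlonglongrightarrow> 0 \<and> (\<lambda>n. F3 (u n) - z3 *\<^sub>C u n) \<longlonglongrightarrow> 0"
proof -
  have e: "0 < 1 / real (Suc n)" for n by simp
  obtain a where a: "\<And>n. norm (a n) = 1" "\<And>n. norm (T1 (a n) - z1 *\<^sub>C a n) < 1 / real (Suc n)"
    using approximate_eigenvector[OF T(1) z(1) spec(1) e] by metis
  obtain b where b: "\<And>n. norm (b n) = 1" "\<And>n. norm (T2 (b n) - z2 *\<^sub>C b n) < 1 / real (Suc n)"
    using approximate_eigenvector[OF T(2) z(2) spec(2) e] by metis
  obtain c where c: "\<And>n. norm (c n) = 1" "\<And>n. norm (T3 (c n) - z3 *\<^sub>C c n) < 1 / real (Suc n)"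
    using approximate_eigenvector[OF T(3) z(3) spec(3) e] by metis
  define u where "u n = t (a n) (b n) (c n)" for n
  have diff: "t (a - a') b c = t a b c - t a' b c" "t a (b - b') c = t a b c - t a b' c"
    "t a b (c - c') = t a b c - t a b c'" for a a' b b' c c'
    using tensor_linear(1)[OF t, of "a - a'" a'] tensor_linear(3)[OF t, of _ "b - b'" b']
      tensor_linear(5)[OF t, of _ _ "c - c'" c'] by (simp_all add: algebra_simps)
  have lim: "v \<longlonglongrightarrow> 0" if "\<And>n. norm (v n) < 1 / real (Suc n)" for v :: "nat \<Rightarrow> 'k"
    by (rule Lim_null_comparison[OF _ LIMSEQ_inverse_real_of_nat])
      (use that in \<open>auto simp: inverse_eq_divide less_imp_le intro!: always_eventually\<close>)
  have "F1 (u n) - z1 *\<^sub>C u n = t (T1 (a n) - z1 *\<^sub>C a n) (b n) (c n)"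
    "F2 (u n) - z2 *\<^sub>C u n = t (a n) (T2 (b n) - z2 *\<^sub>C b n) (c n)"
    "F3 (u n) - z3 *\<^sub>C u n = t (a n) (b n) (T3 (c n) - z3 *\<^sub>C c n)" for n
    unfolding diff tensor_linear[OF t] u_def F1 F2 F3 by simp_all
  then have "(\<lambda>n. F1 (u n) - z1 *\<^sub>C u n) \<longlonglongrightarrow> 0"
    "(\<lambda>n. F2 (u n) - z2 *\<^sub>C u n) \<longlonglongrightarrow> 0" "(\<lambda>n. F3 (u n) - z3 *\<^sub>C u n) \<longlonglongrightarrow> 0"
    by (auto intro!: lim simp: tensor_norm[OF t] a b c simp del: of_nat_Suc)
  moreover have "norm (u n) = 1" for n by (simp add: u_def tensor_norm[OF t] a b c)
  ultimately show ?thesis by (intro exI[of _ u] conjI allI)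
qed

text \<open>On \<open>\<xi> \<otimes> u n\<close> the pencil acts asymptotically as the scalar matrix obtained by putting the approximate
  eigenvalues for the operators.\<close>

lemma pencil_lower_bound:
  fixes u :: "nat \<Rightarrow> 'k::complex_hilbert_space"
  assumes F: "bounded_clinear F1" "bounded_clinear F2" "bounded_clinear F3"
    and u: "\<And>n. norm (u n) = 1" "(\<lambda>n. F1 (u n) - z1 *\<^sub>C u n) \<longlonglongrightarrow> 0"
      "(\<lambda>n. F2 (u n) - z2 *\<^sub>C u n) \<longlonglongrightarrow> 0" "(\<lambda>n. F3 (u n) - z3 *\<^sub>C u n) \<longlonglongrightarrow> 0"
    and bound: "\<And>x. sum_norm_sq k (matrix_app k (pencil V1 V2 V3 F1 F2 F3) x) \<le> M * sum_norm_sq k x"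
  shows "(\<Sum>i<k. (cmod (\<Sum>j<k. (V1 i j * z1 + V2 i j * z2 + V3 i j * z3) * \<xi> j))\<^sup>2)
    \<le> M * (\<Sum>j<k. (cmod (\<xi> j))\<^sup>2)"
proof -
  define \<eta> where "\<eta> i = (\<Sum>j<k. (V1 i j * z1 + V2 i j * z2 + V3 i j * z3) * \<xi> j)" for i
  define X where "X n j = \<xi> j *\<^sub>C u n" for n j
  define E where "E n i j = \<xi> j *\<^sub>C (V1 i j *\<^sub>C (F1 (u n) - z1 *\<^sub>C u n) + V2 i j *\<^sub>C (F2 (u n) - z2 *\<^sub>C u n)
      + V3 i j *\<^sub>C (F3 (u n) - z3 *\<^sub>C u n))" for n i j
  have sc: "(\<lambda>n. c *\<^sub>C s n) \<longlonglongrightarrow> 0" if "s \<longlonglongrightarrow> 0" for s :: "nat \<Rightarrow> 'k" and c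
    using bounded_linear.tendsto[OF bounded_clinear_bounded_linear[OF bounded_clinear_scale[OF bounded_clinear_id(1)]] that]
    by (simp add: complex_vector.scale_zero_right)
  have E0: "(\<lambda>n. \<Sum>j<k. E n i j) \<longlonglongrightarrow> 0" for i
    unfolding E_def
    by (intro tendsto_null_sum sc tendsto_add_zero u)
  have app: "matrix_app k (pencil V1 V2 V3 F1 F2 F3) (X n) i = (\<Sum>j<k. E n i j) + \<eta> i *\<^sub>C u n" for n i
  proof -
    have "pencil V1 V2 V3 F1 F2 F3 i j (X n j) = E n i j + ((V1 i j * z1 + V2 i j * z2 + V3 i j * z3) * \<xi> j) *\<^sub>C u n" for j
      by (simp add: pencil_def X_def E_def bounded_clinearD[OF F(1)] bounded_clinearD[OF F(2)] bounded_clinearD[OF F(3)]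
          scaleC_add_right complex_vector.scale_right_diff_distrib scaleC_scaleC scaleC_add_left distrib_right distrib_left mult_ac)
    then show ?thesis by (simp add: matrix_app_def \<eta>_def sum.distrib complex_vector.scale_sum_left)
  qed
  have "(\<lambda>n. norm (matrix_app k (pencil V1 V2 V3 F1 F2 F3) (X n) i) - cmod (\<eta> i)) \<longlonglongrightarrow> 0" for i
  proof (rule Lim_null_comparison[OF _ tendsto_norm_zero[OF E0]], rule always_eventually, rule allI)
    fix n
    have "cmod (\<eta> i) = norm (\<eta> i *\<^sub>C u n)" by (simp add: norm_scaleC u)
    then show "norm (norm (matrix_app k (pencil V1 V2 V3 F1 F2 F3) (X n) i) - cmod (\<eta> i)) \<le> norm (\<Sum>j<k. E n i j)"
      using norm_triangle_ineq3[of "matrix_app k (pencil V1 V2 V3 F1 F2 F3) (X n) i" "\<eta> i *\<^sub>C u n"] by (simp add: app)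
  qed
  then have "(\<lambda>n. norm (matrix_app k (pencil V1 V2 V3 F1 F2 F3) (X n) i)) \<longlonglongrightarrow> cmod (\<eta> i)" for i
    by (simp add: LIM_zero_iff)
  then have lim: "(\<lambda>n. sum_norm_sq k (matrix_app k (pencil V1 V2 V3 F1 F2 F3) (X n))) \<longlonglongrightarrow> (\<Sum>i<k. (cmod (\<eta> i))\<^sup>2)"
    unfolding sum_norm_sq_def by (intro tendsto_sum tendsto_power)
  have "sum_norm_sq k (matrix_app k (pencil V1 V2 V3 F1 F2 F3) (X n)) \<le> M * (\<Sum>j<k. (cmod (\<xi> j))\<^sup>2)" for n
    using bound[of "X n"] by (simp add: sum_norm_sq_def X_def norm_scaleC u)
  then show ?thesis
    unfolding \<eta>_def[symmetric] by (intro LIMSEQ_le_const2[OF lim]) blast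
qed

lemma mean_of_unimodular:
  assumes "cmod z \<le> 1"
  obtains p q where "cmod p = 1" "cmod q = 1" "z = (p + q) / 2"
proof
  let ?\<phi> = "arccos (cmod z)"
  have "cos ?\<phi> = cmod z" using assms by (intro cos_arccos) (auto intro: order_trans[of _ 0])
  then have "cis (Arg z + ?\<phi>) + cis (Arg z - ?\<phi>) = 2 * rcis (cmod z) (Arg z)"
    by (simp add: complex_eq_iff cos_add cos_diff sin_add sin_diff)
  then show "z = (cis (Arg z + ?\<phi>) + cis (Arg z - ?\<phi>)) / 2" by (simp add: rcis_cmod_Arg)
qed simp_all

text \<open>Each point of the disc is the mean of two points of the circle, so convexity of the squared norm
  replaces the maximum principle.\<close>

lemma affine_bound_on_disc:
  fixes a b :: "nat \<Rightarrow> complex"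
  assumes "\<And>z. cmod z = 1 \<Longrightarrow> (\<Sum>i<k. (cmod (a i + b i * z))\<^sup>2) \<le> K" and "cmod z \<le> 1"
  shows "(\<Sum>i<k. (cmod (a i + b i * z))\<^sup>2) \<le> K"
proof -
  obtain p q where pq: "cmod p = 1" "cmod q = 1" "z = (p + q) / 2"
    using mean_of_unimodular[OF assms(2)] by blast
  have mean: "(cmod ((v + w) / 2))\<^sup>2 \<le> ((cmod v)\<^sup>2 + (cmod w)\<^sup>2) / 2" for v w
  proof -
    have "(cmod (v + w))\<^sup>2 \<le> (cmod v + cmod w)\<^sup>2" by (intro power_mono norm_triangle_ineq) simp
    also have "\<dots> \<le> 2 * ((cmod v)\<^sup>2 + (cmod w)\<^sup>2)"
      using sum_squares_bound[of "cmod v" "cmod w"] by (simp add: power2_sum)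
    finally show ?thesis by (simp add: norm_divide power_divide)
  qed
  have "a i + b i * z = ((a i + b i * p) + (a i + b i * q)) / 2" for i
    by (simp add: pq(3) field_simps)
  then have "(\<Sum>i<k. (cmod (a i + b i * z))\<^sup>2) \<le> (\<Sum>i<k. ((cmod (a i + b i * p))\<^sup>2 + (cmod (a i + b i * q))\<^sup>2) / 2)"
    by (intro sum_mono) (metis mean)
  also have "\<dots> = ((\<Sum>i<k. (cmod (a i + b i * p))\<^sup>2) + (\<Sum>i<k. (cmod (a i + b i * q))\<^sup>2)) / 2"
    by (simp only: sum_divide_distrib[symmetric] sum.distrib)
  also have "\<dots> \<le> K" using assms(1)[OF pq(1)] assms(1)[OF pq(2)] by simp
  finally show ?thesis .
qed

lemma polydisc_bound:
  fixes k :: nat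
  assumes "\<And>z1 z2 z3. cmod z1 = 1 \<Longrightarrow> cmod z2 = 1 \<Longrightarrow> cmod z3 = 1 \<Longrightarrow>
      (\<Sum>i<k. (cmod (\<Sum>j<k. (V1 i j * z1 + V2 i j * z2 + V3 i j * z3) * \<xi> j))\<^sup>2) \<le> K"
    and "cmod z1 \<le> 1" "cmod z2 \<le> 1" "cmod z3 \<le> 1"
  shows "(\<Sum>i<k. (cmod (\<Sum>j<k. (V1 i j * z1 + V2 i j * z2 + V3 i j * z3) * \<xi> j))\<^sup>2) \<le> K"
proof -
  define a b c where "a i = (\<Sum>j<k. V1 i j * \<xi> j)" and "b i = (\<Sum>j<k. V2 i j * \<xi> j)"
    and "c i = (\<Sum>j<k. V3 i j * \<xi> j)" for i
  have eq: "(\<Sum>j<k. (V1 i j * z1 + V2 i j * z2 + V3 i j * z3) * \<xi> j) = a i * z1 + b i * z2 + c i * z3" for i z1 z2 z3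
    unfolding a_def b_def c_def sum_distrib_right sum.distrib[symmetric]
    by (intro sum.cong refl) (simp add: algebra_simps)
  have 3: "(\<Sum>i<k. (cmod (a i * z1 + b i * z2 + c i * z3))\<^sup>2) \<le> K"
    if "cmod z1 = 1" "cmod z2 = 1" "cmod z3 \<le> 1" for z1 z2 z3
    using affine_bound_on_disc[where k = k and a = "\<lambda>i. a i * z1 + b i * z2" and b = c and K = K and z = z3] assms(1)[unfolded eq] that by blast
  have 2: "(\<Sum>i<k. (cmod (a i * z1 + b i * z2 + c i * z3))\<^sup>2) \<le> K"
    if "cmod z1 = 1" "cmod z2 \<le> 1" "cmod z3 \<le> 1" for z1 z2 z3
    using affine_bound_on_disc[where k = k and a = "\<lambda>i. a i * z1 + c i * z3" and b = b and K = K and z = z2] 3 that by (simp add: add_ac)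
  show ?thesis unfolding eq
    using affine_bound_on_disc[where k = k and a = "\<lambda>i. b i * z2 + c i * z3" and b = a and K = K and z = z1] 2 assms(2-4) by (simp add: add_ac)
qed

lemma tensor_pencil_lower_bound:
  fixes t :: "'a::complex_hilbert_space \<Rightarrow> 'b::complex_hilbert_space
      \<Rightarrow> 'c::complex_hilbert_space \<Rightarrow> 'k::complex_hilbert_space"
  assumes t: "hilbert_tensor3 t"
    and T: "contraction T1" "contraction T2" "contraction T3"
    and spec: "sphere 0 1 \<subseteq> spectrum T1" "sphere 0 1 \<subseteq> spectrum T2" "sphere 0 1 \<subseteq> spectrum T3"
    and F1: "bounded_clinear F1" "\<And>a b c. F1 (t a b c) = t (T1 a) b c"
    and F2: "bounded_clinear F2" "\<And>a b c. F2 (t a b c) = t a (T2 b) c"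
    and F3: "bounded_clinear F3" "\<And>a b c. F3 (t a b c) = t a b (T3 c)"
    and bound: "\<And>x. sum_norm_sq k (matrix_app k (pencil V1 V2 V3 F1 F2 F3) x) \<le> M * sum_norm_sq k x"
    and z: "cmod z1 \<le> 1" "cmod z2 \<le> 1" "cmod z3 \<le> 1"
  shows "(\<Sum>i<k. (cmod (\<Sum>j<k. (V1 i j * z1 + V2 i j * z2 + V3 i j * z3) * \<xi> j))\<^sup>2)
    \<le> M * (\<Sum>j<k. (cmod (\<xi> j))\<^sup>2)"
proof -
  have torus: "(\<Sum>i<k. (cmod (\<Sum>j<k. (V1 i j * z1 + V2 i j * z2 + V3 i j * z3) * \<xi> j))\<^sup>2)
    \<le> M * (\<Sum>j<k. (cmod (\<xi> j))\<^sup>2)"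
    if z: "cmod z1 = 1" "cmod z2 = 1" "cmod z3 = 1" for z1 z2 z3
  proof -
  have "z1 \<in> spectrum T1" "z2 \<in> spectrum T2" "z3 \<in> spectrum T3" using spec z by auto
  from joint_approximate_eigenvectors[where t = t and ?T1.0 = T1 and ?T2.0 = T2 and ?T3.0 = T3 and ?F1.0 = F1 and ?F2.0 = F2 and ?F3.0 = F3,
      OF t T this z F1(2) F2(2) F3(2)]
  obtain u where u: "\<forall>n. norm (u n) = 1" "(\<lambda>n. F1 (u n) - z1 *\<^sub>C u n) \<longlonglongrightarrow> 0"
      "(\<lambda>n. F2 (u n) - z2 *\<^sub>C u n) \<longlonglongrightarrow> 0" "(\<lambda>n. F3 (u n) - z3 *\<^sub>C u n) \<longlonglongrightarrow> 0"
    by (elim exE conjE)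
  show ?thesis
    by (rule pencil_lower_bound[where u = u, OF F1(1) F2(1) F3(1) u(1)[rule_format] u(2-4) bound])
  qed
  show ?thesis
    by (rule polydisc_bound[OF torus z])
qed

section \<open>Matrix norms and functionals\<close>

lemma op_matrix_norm_le:
  assumes c: "0 \<le> c" and bound: "\<And>x. sum_norm_sq k (matrix_app k A x) \<le> c\<^sup>2 * sum_norm_sq k x"
  shows "op_matrix_norm k A \<le> c"
  unfolding op_matrix_norm_def
proof (rule cSup_least)
  show "{sqrt (\<Sum>i<k. (norm (\<Sum>j<k. A i j (x j)))\<^sup>2) |x. (\<Sum>j<k. (norm (x j))\<^sup>2) \<le> 1} \<noteq> {}"
    by (auto intro!: exI[of _ "\<lambda>_. 0"])
  fix r assume "r \<in> {sqrt (\<Sum>i<k. (norm (\<Sum>j<k. A i j (x j)))\<^sup>2) |x. (\<Sum>j<k. (norm (x j))\<^sup>2) \<le> 1}"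
  then obtain x where r: "r = sqrt (sum_norm_sq k (matrix_app k A x))" and x: "sum_norm_sq k x \<le> 1"
    by (auto simp: sum_norm_sq_def matrix_app_def)
  have "sum_norm_sq k (matrix_app k A x) \<le> c\<^sup>2 * 1"
    using bound[of x] x by (meson mult_left_mono order_trans zero_le_power2)
  then show "r \<le> c" unfolding r using c by (simp add: real_le_lsqrt sum_norm_sq_nonneg)
qed

lemma op_matrix_norm_bound:
  fixes A :: "nat \<Rightarrow> nat \<Rightarrow> 'h::complex_hilbert_space \<Rightarrow> 'h"
  assumes A: "\<And>i j. bounded_clinear (A i j)"
  shows "0 \<le> op_matrix_norm k A" and "sum_norm_sq k (matrix_app k A x) \<le> (op_matrix_norm k A)\<^sup>2 * sum_norm_sq k x"
proof -
  let ?X = "{sqrt (\<Sum>i<k. (norm (\<Sum>j<k. A i j (x j)))\<^sup>2) |x. (\<Sum>j<k. (norm (x j))\<^sup>2) \<le> 1}"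
  have bdd: "bdd_above ?X"
  proof (rule bdd_aboveI)
    fix r assume "r \<in> ?X"
    then obtain x where r: "r = sqrt (\<Sum>i<k. (norm (\<Sum>j<k. A i j (x j)))\<^sup>2)" and x: "(\<Sum>j<k. (norm (x j))\<^sup>2) \<le> 1"
      by blast
    have x1: "norm (x j) \<le> 1" if "j < k" for j
    proof -
      have "(norm (x j))\<^sup>2 \<le> (\<Sum>j<k. (norm (x j))\<^sup>2)" by (rule member_le_sum) (use that in auto)
      with x have "(norm (x j))\<^sup>2 \<le> 1\<^sup>2" by simp
      then show ?thesis by (rule power2_le_imp_le) simp
    qed
    have "norm (A i j (x j)) \<le> onorm (A i j) * 1" if "j < k" for i j
      using bounded_clinear_norm[OF A] x1[OF that]
      by (meson A bounded_clinear_bounded_linear mult_left_mono onorm_pos_le order_trans)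
    then have "norm (\<Sum>j<k. A i j (x j)) \<le> (\<Sum>j<k. onorm (A i j))" for i
      by (intro order_trans[OF norm_sum] sum_mono) simp
    then show "r \<le> sqrt (\<Sum>i<k. (\<Sum>j<k. onorm (A i j))\<^sup>2)"
      unfolding r by (intro real_sqrt_le_mono sum_mono power_mono) simp_all
  qed
  have unit: "sqrt (sum_norm_sq k (matrix_app k A x)) \<le> op_matrix_norm k A" if "sum_norm_sq k x \<le> 1" for x
    unfolding op_matrix_norm_def
    by (rule cSup_upper[OF _ bdd]) (use that in \<open>auto simp: sum_norm_sq_def matrix_app_def\<close>)
  show nonneg: "0 \<le> op_matrix_norm k A"
    by (rule order_trans[OF _ unit[of "\<lambda>_. 0"]]) (simp_all add: sum_norm_sq_nonneg, simp add: sum_norm_sq_def)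
  show "sum_norm_sq k (matrix_app k A x) \<le> (op_matrix_norm k A)\<^sup>2 * sum_norm_sq k x"
  proof (cases "sum_norm_sq k x = 0")
    case True
    then have "x j = 0" if "j < k" for j
      using that by (simp add: sum_norm_sq_def sum_nonneg_eq_0_iff)
    then have "matrix_app k A x i = 0" for i
      by (simp add: matrix_app_def bounded_clinear_zero[OF A])
    then show ?thesis using True by (simp add: sum_norm_sq_def)
  next
    case False
    define s where "s = sqrt (sum_norm_sq k x)"
    have s: "s > 0" "s\<^sup>2 = sum_norm_sq k x" using False sum_norm_sq_nonneg[of k x] by (auto simp: s_def)
    have scale: "sum_norm_sq k (\<lambda>j. complex_of_real (1 / s) *\<^sub>C v j) = sum_norm_sq k v / s\<^sup>2" for v :: "nat \<Rightarrow> 'h"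
      using s(1) by (simp add: sum_norm_sq_def norm_scaleC norm_divide power_divide sum_divide_distrib)
    have "matrix_app k A (\<lambda>j. complex_of_real (1 / s) *\<^sub>C x j) = (\<lambda>i. complex_of_real (1 / s) *\<^sub>C matrix_app k A x i)"
      unfolding matrix_app_def by (simp only: bounded_clinear_scaleC[OF A] complex_vector.scale_sum_right)
    moreover have "sum_norm_sq k (\<lambda>j. complex_of_real (1 / s) *\<^sub>C x j) \<le> 1"
      unfolding scale using s by simp
    ultimately have "sqrt (sum_norm_sq k (matrix_app k A x) / s\<^sup>2) \<le> op_matrix_norm k A"
      using unit[of "\<lambda>j. complex_of_real (1 / s) *\<^sub>C x j"] by (simp only: scale)
    then have "sum_norm_sq k (matrix_app k A x) / s\<^sup>2 \<le> (op_matrix_norm k A)\<^sup>2"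
      by (rule sqrt_le_D)
    then show ?thesis unfolding s(2)[symmetric] using s(1) by (simp add: divide_le_eq)
  qed
qed

lemma functional_on_l1_3:
  fixes g :: "3 l1 \<Rightarrow> complex"
  assumes "bounded_clinear g" "onorm g \<le> 1"
  obtains z1 z2 z3 where "cmod z1 \<le> 1" "cmod z2 \<le> 1" "cmod z3 \<le> 1"
    "\<And>a. g a = l1_nth a 1 * z1 + l1_nth a 2 * z2 + l1_nth a 3 * z3"
proof
  define e :: "3 \<Rightarrow> 3 l1" where "e m = l1_of (\<lambda>i. if i = m then 1 else 0)" for m
  have nth: "l1_nth (e m) i = (if i = m then 1 else 0)" for m i
    by (simp add: e_def l1_of_inverse)
  have "cmod (l1_nth (e m) i) = (if i = m then 1 else 0)" for m i
    by (simp add: nth)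
  then have ne: "norm (e m) = 1" for m
    by (simp add: norm_l1.rep_eq)
  have "cmod (g a) \<le> 1 * norm a" for a
    using bounded_clinear_norm[OF assms(1), of a] assms(2) by (meson mult_right_mono norm_ge_zero order_trans)
  from this[of "e 1"] this[of "e 2"] this[of "e 3"]
  show "cmod (g (e 1)) \<le> 1" "cmod (g (e 2)) \<le> 1" "cmod (g (e 3)) \<le> 1" by (simp_all add: ne)
  fix a :: "3 l1"
  have "a = l1_nth a 1 *\<^sub>C e 1 + l1_nth a 2 *\<^sub>C e 2 + l1_nth a 3 *\<^sub>C e 3"
  proof (rule l1_eqI)
    fix i :: 3
    show "l1_nth a i = l1_nth (l1_nth a 1 *\<^sub>C e 1 + l1_nth a 2 *\<^sub>C e 2 + l1_nth a 3 *\<^sub>C e 3) i"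
      using exhaust_3[of i] by (auto simp: plus_l1.rep_eq scaleC_l1.rep_eq nth)
  qed
  from arg_cong[OF this, of g]
  show "g a = l1_nth a 1 * g (e 1) + l1_nth a 2 * g (e 2) + l1_nth a 3 * g (e 3)"
    unfolding bounded_clinear_add[OF assms(1)] bounded_clinear_scaleC[OF assms(1)] scaleC_complex_def .
qed

lemma unimodular_functional_on_l1_3:
  assumes "cmod z1 = 1" "cmod z2 = 1" "cmod z3 = 1"
  shows "bounded_clinear (\<lambda>a :: 3 l1. l1_nth a 1 * z1 + l1_nth a 2 * z2 + l1_nth a 3 * z3)" (is "bounded_clinear ?g")
    and "onorm (\<lambda>a :: 3 l1. l1_nth a 1 * z1 + l1_nth a 2 * z2 + l1_nth a 3 * z3) \<le> 1"
proof -
  have n: "cmod (?g a) \<le> norm a * 1" for a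
    using norm_triangle_ineq[of "l1_nth a 1 * z1 + l1_nth a 2 * z2" "l1_nth a 3 * z3"]
      norm_triangle_ineq[of "l1_nth a 1 * z1" "l1_nth a 2 * z2"]
    by (simp add: norm_mult assms norm_l1_3)
  show "bounded_clinear ?g"
    by (rule bounded_clinearI[of _ 1, OF _ _ n])
      (simp_all add: plus_l1.rep_eq scaleC_l1.rep_eq scaleC_complex_def algebra_simps)
  show "onorm ?g \<le> 1"
    by (rule onorm_bound) (use n in simp_all)
qed

lemma tensor_op3_eq:
  assumes "hilbert_tensor3 t" "bounded_clinear F" "\<And>a b c. F (t a b c) = t (A a) (B b) (C c)"
  shows "tensor_op3 t A B C = F"
  unfolding tensor_op3_def
proof (rule the_equality)
  show "bounded_clinear F \<and> (\<forall>x y z. F (t x y z) = t (A x) (B y) (C z))" using assms by blast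
  fix G assume "bounded_clinear G \<and> (\<forall>x y z. G (t x y z) = t (A x) (B y) (C z))"
  then show "G = F" using assms by (intro tensor_ext[OF assms(1)]) auto
qed

lemma bounded_clinear_scalar_mult: "bounded_clinear (\<lambda>z :: complex. c * z)"
  by (rule bounded_clinearI[of _ "cmod c"]) (simp_all add: scaleC_complex_def norm_mult algebra_simps)

section \<open>The induced operator space structure\<close>

theorem mainTheorem12:
  fixes T1 :: "'a::complex_hilbert_space \<Rightarrow> 'a"
    and T2 :: "'b::complex_hilbert_space \<Rightarrow> 'b"
    and T3 :: "'c::complex_hilbert_space \<Rightarrow> 'c"
    and t :: "'a \<Rightarrow> 'b \<Rightarrow> 'c \<Rightarrow> 'k::complex_hilbert_space"
    and f :: "3 l1 \<Rightarrow> 'k \<Rightarrow> 'k"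
  assumes "hilbert_tensor3 t"
    and "contraction T1" and "contraction T2" and "contraction T3"
    and "sphere 0 1 \<subseteq> spectrum T1"
    and "sphere 0 1 \<subseteq> spectrum T2"
    and "sphere 0 1 \<subseteq> spectrum T3"
  defines "f \<equiv> \<lambda>a x. l1_nth a 1 *\<^sub>C tensor_op3 t T1 id id x
                   + l1_nth a 2 *\<^sub>C tensor_op3 t id T2 id x
                   + l1_nth a 3 *\<^sub>C tensor_op3 t id id T3 x"
  shows "isometry_into_operators f \<and> complete_isometry min_matrix_norm f"
proof -
  note t = assms(1) and T = assms(2-4)
  have spec: "z \<in> spectrum T1" "z \<in> spectrum T2" "z \<in> spectrum T3" if "cmod z = 1" for z
    using that assms(5-7) by auto
  have one: "cmod 1 = 1" and pos: "(0 :: real) < 1" by simp_all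
  obtain h1 where h1: "norm (h1 :: 'a) = 1"
    using approximate_eigenvector[OF T(1) one spec(1)[OF one] pos] by blast
  obtain h2 where h2: "norm (h2 :: 'b) = 1"
    using approximate_eigenvector[OF T(2) one spec(2)[OF one] pos] by blast
  obtain h3 where h3: "norm (h3 :: 'c) = 1"
    using approximate_eigenvector[OF T(3) one spec(3)[OF one] pos] by blast
  note t1 = hilbert_tensor3_rotate[OF t] and t2 = hilbert_tensor3_rotate[OF hilbert_tensor3_rotate[OF t]]
  obtain F1 where F1: "bounded_clinear F1" "\<And>a b c. F1 (t a b c) = t (T1 a) b c" "\<And>x. norm (F1 x) \<le> norm x"
    using slot3_operator_exists[OF t1 contractionD[OF T(1)] h1] by blast
  obtain F2 where F2: "bounded_clinear F2" "\<And>a b c. F2 (t a b c) = t a (T2 b) c" "\<And>x. norm (F2 x) \<le> norm x"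
    using slot3_operator_exists[OF t2 contractionD[OF T(2)] h2] by blast
  obtain F3 where F3: "bounded_clinear F3" "\<And>a b c. F3 (t a b c) = t a b (T3 c)" "\<And>x. norm (F3 x) \<le> norm x"
    using slot3_operator_exists[OF t contractionD[OF T(3)] h3] by blast
  have f: "f = (\<lambda>a x. l1_nth a 1 *\<^sub>C F1 x + l1_nth a 2 *\<^sub>C F2 x + l1_nth a 3 *\<^sub>C F3 x)"
    unfolding f_def
    by (simp add: tensor_op3_eq[OF t F1(1)] tensor_op3_eq[OF t F2(1)] tensor_op3_eq[OF t F3(1)] F1(2) F2(2) F3(2))
  have fb: "bounded_clinear (f w)" for w
    unfolding f by (intro bounded_clinear_plus bounded_clinear_scale F1 F2 F3)
  have flin: "linear_into_operators f"
    unfolding linear_into_operators_def Vector_Spaces.linear_iff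
    by (intro conjI allI fb)
      (simp_all add: f plus_l1.rep_eq scaleC_l1.rep_eq scaleC_add_left scaleC_add_right scaleC_scaleC add_ac
        complex_vector.vector_space_axioms)
  let ?P = "\<lambda>v. pencil (\<lambda>i j. l1_nth (v i j) 1) (\<lambda>i j. l1_nth (v i j) 2) (\<lambda>i j. l1_nth (v i j) 3) F1 F2 F3"
  have fP: "matrix_app k (\<lambda>i j. f (v i j)) = matrix_app k (?P v)" for k v
    by (rule arg_cong[of _ _ "matrix_app k"], intro ext) (simp add: f pencil_def)
  have lower: "(\<Sum>i<k. (cmod (\<Sum>j<k. (l1_nth (v i j) 1 * z1 + l1_nth (v i j) 2 * z2 + l1_nth (v i j) 3 * z3) * \<xi> j))\<^sup>2)
      \<le> M * (\<Sum>j<k. (cmod (\<xi> j))\<^sup>2)"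
    if bound: "\<And>x. sum_norm_sq k (matrix_app k (\<lambda>i j. f (v i j)) x) \<le> M * sum_norm_sq k x"
      and z: "cmod z1 \<le> 1" "cmod z2 \<le> 1" "cmod z3 \<le> 1" for k v M z1 z2 z3 \<xi>
  proof -
    have "sum_norm_sq k (matrix_app k (?P v) x) \<le> M * sum_norm_sq k x" for x using bound[of x] unfolding fP[of k v] .
    then show ?thesis
      by (rule tensor_pencil_lower_bound[where t = t and ?T1.0 = T1 and ?T2.0 = T2 and ?T3.0 = T3 and ?F1.0 = F1 and ?F2.0 = F2 and ?F3.0 = F3,
            OF t T assms(5-7) F1(1,2) F2(1,2) F3(1,2) _ z])
  qed
  have iso: "onorm (f w) = norm w" for w
  proof (rule antisym)
    show "onorm (f w) \<le> norm w"
    proof (rule onorm_bound)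
      fix x
      have "norm (f w x) \<le> cmod (l1_nth w 1) * norm (F1 x) + cmod (l1_nth w 2) * norm (F2 x) + cmod (l1_nth w 3) * norm (F3 x)"
        unfolding f norm_scaleC[symmetric] by (intro norm_triangle_le add_mono norm_triangle_ineq order_refl)
      also have "\<dots> \<le> cmod (l1_nth w 1) * norm x + cmod (l1_nth w 2) * norm x + cmod (l1_nth w 3) * norm x"
        by (intro add_mono mult_left_mono F1 F2 F3) simp_all
      finally show "norm (f w x) \<le> norm w * norm x" by (simp add: norm_l1_3 algebra_simps)
    qed simp
    have un: "\<exists>z. cmod z \<le> 1 \<and> a * z = of_real (cmod a)" for a
    proof (cases "a = 0")
      case False
      have "a * (cnj a / of_real (cmod a)) = of_real (cmod a)"
        using False complex_norm_square[of a] by (simp add: power2_eq_square field_simps)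
      then show ?thesis using False by (intro exI[of _ "cnj a / of_real (cmod a)"]) (simp add: norm_divide)
    qed (auto intro: exI[of _ 0])
    obtain z1 z2 z3 where z: "cmod z1 \<le> 1" "cmod z2 \<le> 1" "cmod z3 \<le> 1"
      and wz: "l1_nth w 1 * z1 = of_real (cmod (l1_nth w 1))" "l1_nth w 2 * z2 = of_real (cmod (l1_nth w 2))"
        "l1_nth w 3 * z3 = of_real (cmod (l1_nth w 3))"
      using un[of "l1_nth w 1"] un[of "l1_nth w 2"] un[of "l1_nth w 3"] by blast
    have "(norm (f w y))\<^sup>2 \<le> (onorm (f w) * norm y)\<^sup>2" for y
      by (rule power_mono[OF bounded_clinear_norm[OF fb[of w]] norm_ge_zero])
    then have "sum_norm_sq 1 (matrix_app 1 (\<lambda>i j. f w) x) \<le> (onorm (f w))\<^sup>2 * sum_norm_sq 1 x" for x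
      by (simp add: sum_norm_sq_def matrix_app_def power_mult_distrib)
    then have "(\<Sum>i<1::nat. (cmod (\<Sum>j<1::nat. (l1_nth w 1 * z1 + l1_nth w 2 * z2 + l1_nth w 3 * z3) * 1))\<^sup>2)
      \<le> (onorm (f w))\<^sup>2 * (\<Sum>j<1::nat. (cmod 1)\<^sup>2)"
      by (rule lower[of 1 "\<lambda>_ _. w" "(onorm (f w))\<^sup>2" z1 z2 z3 "\<lambda>_. 1", OF _ z])
    then have "(cmod (of_real (norm w)))\<^sup>2 \<le> (onorm (f w))\<^sup>2"
      by (simp add: wz norm_l1_3 flip: of_real_add)
    then show "norm w \<le> onorm (f w)"
      using onorm_pos_le[OF bounded_clinear_bounded_linear[OF fb]] by (simp add: power2_le_iff_abs_le)
  qed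
  have complete: "op_matrix_norm k (\<lambda>i j. f (v i j)) = min_matrix_norm k v" for k v
  proof (rule antisym)
    let ?N = "op_matrix_norm k (\<lambda>i j. f (v i j))"
    let ?S = "{scalar_matrix_norm k (\<lambda>i j. g (v i j)) | g. bounded_clinear g \<and> onorm g \<le> 1}"
    note N = op_matrix_norm_bound[of "\<lambda>i j. f (v i j)" k, OF fb]
    have le: "r \<le> ?N" if "r \<in> ?S" for r
    proof -
      obtain g where r: "r = scalar_matrix_norm k (\<lambda>i j. g (v i j))" and g: "bounded_clinear g" "onorm g \<le> 1"
        using \<open>r \<in> ?S\<close> by blast
      obtain z1 z2 z3 where z: "cmod z1 \<le> 1" "cmod z2 \<le> 1" "cmod z3 \<le> 1"
        and gz: "\<And>a. g a = l1_nth a 1 * z1 + l1_nth a 2 * z2 + l1_nth a 3 * z3"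
        by (rule functional_on_l1_3[OF g]) (rule that)
      show ?thesis unfolding r scalar_matrix_norm_def
        by (rule op_matrix_norm_le[OF N(1)]) (use lower[OF N(2) z] in \<open>simp add: sum_norm_sq_def matrix_app_def gz\<close>)
    qed
    have zero: "bounded_clinear (\<lambda>w :: 3 l1. 0 :: complex)" "onorm (\<lambda>w :: 3 l1. 0 :: complex) \<le> 1"
      by (rule bounded_clinearI[of _ 0]) (simp_all add: scaleC_complex_def onorm_zero)
    then have ne: "?S \<noteq> {}" by blast
    then show "min_matrix_norm k v \<le> ?N"
      unfolding min_matrix_norm_def by (rule cSup_least) (rule le)
    have bdd: "bdd_above ?S" by (rule bdd_aboveI) (rule le)
    have up: "scalar_matrix_norm k (\<lambda>i j. g (v i j)) \<le> min_matrix_norm k v"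
      if "bounded_clinear g" "onorm g \<le> 1" for g
      unfolding min_matrix_norm_def by (rule cSup_upper[OF _ bdd]) (use that in blast)
    have scalar: "0 \<le> scalar_matrix_norm k V"
      "(\<Sum>i<k. (cmod (\<Sum>j<k. V i j * \<xi> j))\<^sup>2) \<le> (scalar_matrix_norm k V)\<^sup>2 * (\<Sum>j<k. (cmod (\<xi> j))\<^sup>2)" for V \<xi>
      using op_matrix_norm_bound[of "\<lambda>i j z. V i j * z" k, OF bounded_clinear_scalar_mult]
      by (simp_all add: scalar_matrix_norm_def sum_norm_sq_def matrix_app_def)
    have min0: "0 \<le> min_matrix_norm k v"
      by (rule order_trans[OF scalar(1) up[OF zero]])
    show "?N \<le> min_matrix_norm k v"
    proof (rule op_matrix_norm_le[OF min0])
      fix x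
      have "sum_norm_sq k (matrix_app k (?P v) x) \<le> (min_matrix_norm k v)\<^sup>2 * sum_norm_sq k x"
      proof (rule pencil_upper_bound[where t = t and ?T1.0 = T1 and ?T2.0 = T2 and ?T3.0 = T3 and ?F1.0 = F1 and ?F2.0 = F2 and ?F3.0 = F3,
          OF t h1 h2 h3 contractionD[OF T(1)] contractionD[OF T(2)] contractionD[OF T(3)] F1 F2 F3])
        fix z1 z2 z3 \<xi> assume z: "cmod z1 = 1" "cmod z2 = 1" "cmod z3 = 1"
        let ?V = "\<lambda>i j. l1_nth (v i j) 1 * z1 + l1_nth (v i j) 2 * z2 + l1_nth (v i j) 3 * z3"
        have "scalar_matrix_norm k ?V \<le> min_matrix_norm k v"
          using up[OF unimodular_functional_on_l1_3[OF z]] .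
        then have "(scalar_matrix_norm k ?V)\<^sup>2 * (\<Sum>j<k. (cmod (\<xi> j))\<^sup>2) \<le> (min_matrix_norm k v)\<^sup>2 * (\<Sum>j<k. (cmod (\<xi> j))\<^sup>2)"
          by (intro mult_right_mono power_mono scalar(1) sum_nonneg) simp_all
        then show "(\<Sum>i<k. (cmod (\<Sum>j<k. ?V i j * \<xi> j))\<^sup>2) \<le> (min_matrix_norm k v)\<^sup>2 * (\<Sum>j<k. (cmod (\<xi> j))\<^sup>2)"
          by (rule order_trans[OF scalar(2)])
      qed
      then show "sum_norm_sq k (matrix_app k (\<lambda>i j. f (v i j)) x) \<le> (min_matrix_norm k v)\<^sup>2 * sum_norm_sq k x"
        unfolding fP[of k v] .
    qed
  qed
  show ?thesis
    unfolding isometry_into_operators_def complete_isometry_def using flin iso complete by blast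
qed

end
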